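(* Let $L=(L_t)_{t\in\mathbb{R}}$ be a two-sided Lévy process in $\mathbb{R}^d$ with $\mathbb{E}[L_1]=0$, $\mathbb{E}[\|L_1\|^2]<\infty$ and generating triplet $(\gamma,\Sigma,\nu)$ with $\nu(\mathbb{R}^d)\neq0$. Let $$M(A)=\frac{1}{\sqrt{2\pi}}\int_{-\infty}^{\infty}\widehat{1_A}(\mu)\,L(d\mu),\qquad A\in\mathcal{E}(\mathbb{R}).$$ Then $M$ is neither independently scattered nor stationarily scattered.
   Context: $\mathcal{E}(\mathbb{R})$ is the ring generated by the half-open bounded intervals $[a,b)$, $-\infty<a<b<\infty$. $\widehat{1_A}(\mu)=\frac{1}{\sqrt{2\pi}}\int_Ae^{-i\mu x}dx$, which lies in $L^2(\mathbb{R};\mathbb{C})$. $M$ is independently scattered if $M(A_1),\dots,M(A_n)$ are independent whenever $A_1,\dots,A_n\in\mathcal{E}(\mathbb{R})$ are pairwise disjoint. $M$ is stationarily scattered if for every $\tau\in\mathbb{R}$ the families $\{M(A):A\in\mathcal{E}(\mathbb{R})\}$ and $\{M(A+\tau):A\in\mathcal{E}(\mathbb{R})\}$ have the same finite-dimensional distributions. Two-sided Lévy process: $L_0=0$ a.s., independent stationary increments, $\mathbb{E}[e^{i\langle z,L_t\rangle}]=\exp\{|t|\psi_L(\mathrm{sgn}(t)z)\}$, $\psi_L(z)=i\langle\gamma,z\rangle-\tfrac12\langle z,\Sigma z\rangle+\int_{\mathbb{R}^d}(e^{i\langle z,x\rangle}-1-i\langle z,x\rangle1_{[0,1]}(\|x\|))\nu(dx)$;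 $(\gamma,\Sigma,\nu)$ is the generating triplet, $\nu$ the Lévy measure. Since $L$ is centered and square-integrable, $\int f\,dL$ is the usual $L^2$-integral: for simple $f=\sum_if_i1_{[a_i,b_i)}$ it equals $\sum_if_i(L_{b_i}-L_{a_i})$, and it is extended by $L^2$-continuity to all $f\in L^2(\mathbb{R};\mathbb{C})$. *)

theory Defs
  imports "HOL-Probability.Probability"
begin

definition interval_ring :: "real set set" where
  "interval_ring = ring_of_sets UNIV hull {{a..<b} | a b. a < b}"

definition fourier_indicator :: "real set \<Rightarrow> real \<Rightarrow> complex" where
  "fourier_indicator A \<mu> =
     of_real (1 / sqrt (2 * pi)) *
     (LINT x:A|lborel. exp (- \<i> * of_real \<mu> * of_real x))"

definition levy_measure :: "(real ^ 'd) measure \<Rightarrow> bool" where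
  "levy_measure \<nu> \<longleftrightarrow>
     sets \<nu> = sets borel \<and> emeasure \<nu> {0} = 0 \<and>
     (\<integral>\<^sup>+ x. ennreal (min 1 ((norm x)\<^sup>2)) \<partial>\<nu>) < \<infinity>"

definition generating_triplet ::
  "real ^ 'd \<Rightarrow> real ^ 'd ^ 'd \<Rightarrow> (real ^ 'd) measure \<Rightarrow> bool" where
  "generating_triplet \<gamma> S \<nu> \<longleftrightarrow>
     transpose S = S \<and> (\<forall>z. 0 \<le> z \<bullet> (S *v z)) \<and> levy_measure \<nu>"

definition levy_exponent ::
  "real ^ 'd \<Rightarrow> real ^ 'd ^ 'd \<Rightarrow> (real ^ 'd) measure \<Rightarrow> real ^ 'd \<Rightarrow> complex" where
  "levy_exponent \<gamma> S \<nu> z =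
     \<i> * of_real (\<gamma> \<bullet> z) - of_real (z \<bullet> (S *v z)) / 2 +
     (LINT x|\<nu>. exp (\<i> * of_real (z \<bullet> x)) - 1
        - \<i> * of_real (z \<bullet> x) * indicator {0..1} (norm x))"

definition independent_increments :: "'a measure \<Rightarrow> (real \<Rightarrow> 'a \<Rightarrow> real ^ 'd) \<Rightarrow> bool" where
  "independent_increments P L \<longleftrightarrow>
     (\<forall>(n :: nat) t. strict_mono_on {..n} t \<longrightarrow>
        prob_space.indep_vars P (\<lambda>_. borel) (\<lambda>i \<omega>. L (t (Suc i)) \<omega> - L (t i) \<omega>) {..<n})"

definition stationary_increments :: "'a measure \<Rightarrow> (real \<Rightarrow> 'a \<Rightarrow> real ^ 'd) \<Rightarrow> bool" where
  "stationary_increments P L \<longleftrightarrow>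
     (\<forall>s t h. distr P borel (\<lambda>\<omega>. L (t + h) \<omega> - L (s + h) \<omega>)
            = distr P borel (\<lambda>\<omega>. L t \<omega> - L s \<omega>))"

text \<open>No path regularity is required; stochastic continuity follows from the
  formula for the characteristic function.\<close>

definition two_sided_levy_process ::
  "'a measure \<Rightarrow> (real \<Rightarrow> 'a \<Rightarrow> real ^ 'd) \<Rightarrow>
   real ^ 'd \<Rightarrow> real ^ 'd ^ 'd \<Rightarrow> (real ^ 'd) measure \<Rightarrow> bool" where
  "two_sided_levy_process P L \<gamma> S \<nu> \<longleftrightarrow>
     prob_space P \<and>
     (\<forall>t. L t \<in> borel_measurable P) \<and>
     (AE \<omega> in P. L 0 \<omega> = 0) \<and>
     independent_increments P L \<and>
     stationary_increments P L \<and>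
     generating_triplet \<gamma> S \<nu> \<and>
     (\<forall>t z. (LINT \<omega>|P. exp (\<i> * of_real (z \<bullet> L t \<omega>)))
          = exp (of_real \<bar>t\<bar> * levy_exponent \<gamma> S \<nu> (sgn t *\<^sub>R z)))"

text \<open>A list of triples (c, a, b) represents the simple function that is the sum of the
  functions c times the indicator of [a, b).  The side condition on the endpoints matters:
  for b < a the indicator vanishes but the increment from a to b does not.\<close>

definition step_repr :: "(complex \<times> real \<times> real) list \<Rightarrow> bool" where
  "step_repr xs \<longleftrightarrow> (\<forall>(c, a, b) \<in> set xs. a < b)"

definition step_fun :: "(complex \<times> real \<times> real) list \<Rightarrow> real \<Rightarrow> complex" where
  "step_fun xs \<mu> = (\<Sum>(c, a, b)\<leftarrow>xs. c * indicator {a..<b} \<mu>)"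

definition step_integral ::
  "(real \<Rightarrow> 'a \<Rightarrow> real ^ 'd) \<Rightarrow> (complex \<times> real \<times> real) list \<Rightarrow> 'a \<Rightarrow> complex ^ 'd" where
  "step_integral L xs \<omega> =
     (\<Sum>(c, a, b)\<leftarrow>xs. \<chi> j. c * of_real ((L b \<omega> - L a \<omega>) $ j))"

definition has_L2_integral ::
  "'a measure \<Rightarrow> (real \<Rightarrow> 'a \<Rightarrow> real ^ 'd) \<Rightarrow> (real \<Rightarrow> complex) \<Rightarrow> ('a \<Rightarrow> complex ^ 'd) \<Rightarrow> bool"
where
  "has_L2_integral P L f X \<longleftrightarrow>
     f \<in> borel_measurable lborel \<and> integrable lborel (\<lambda>\<mu>. (cmod (f \<mu>))\<^sup>2) \<and>
     X \<in> borel_measurable P \<and> integrable P (\<lambda>\<omega>. (norm (X \<omega>))\<^sup>2) \<and>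
     (\<exists>xs :: nat \<Rightarrow> (complex \<times> real \<times> real) list.
        (\<forall>n. step_repr (xs n)) \<and>
        (\<lambda>n. \<integral>\<^sup>+ \<mu>. ennreal ((cmod (step_fun (xs n) \<mu> - f \<mu>))\<^sup>2) \<partial>lborel)
          \<longlonglongrightarrow> 0 \<and>
        (\<lambda>n. \<integral>\<^sup>+ \<omega>. ennreal ((norm (step_integral L (xs n) \<omega> - X \<omega>))\<^sup>2) \<partial>P)
          \<longlonglongrightarrow> 0)"

text \<open>The integral is determined only up to almost sure equality; this picks a version.\<close>

definition L2_integral ::
  "'a measure \<Rightarrow> (real \<Rightarrow> 'a \<Rightarrow> real ^ 'd) \<Rightarrow> (real \<Rightarrow> complex) \<Rightarrow> 'a \<Rightarrow> complex ^ 'd" where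
  "L2_integral P L f = (SOME X. has_L2_integral P L f X)"

definition independently_scattered ::
  "'a measure \<Rightarrow> (real set \<Rightarrow> 'a \<Rightarrow> complex ^ 'd) \<Rightarrow> bool" where
  "independently_scattered P M \<longleftrightarrow>
     (\<forall>(n :: nat) A. (\<forall>i<n. A i \<in> interval_ring) \<and> disjoint_family_on A {..<n} \<longrightarrow>
        prob_space.indep_vars P (\<lambda>_. borel) (\<lambda>i. M (A i)) {..<n})"

definition stationarily_scattered ::
  "'a measure \<Rightarrow> (real set \<Rightarrow> 'a \<Rightarrow> complex ^ 'd) \<Rightarrow> bool" where
  "stationarily_scattered P M \<longleftrightarrow>
     (\<forall>\<tau> (n :: nat) A. (\<forall>i<n. A i \<in> interval_ring) \<longrightarrow>
        distr P (\<Pi>\<^sub>M i\<in>{..<n}. borel) (\<lambda>\<omega>. \<lambda>i\<in>{..<n}. M (A i) \<omega>)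
      = distr P (\<Pi>\<^sub>M i\<in>{..<n}. borel) (\<lambda>\<omega>. \<lambda>i\<in>{..<n}. M ((\<lambda>x. x + \<tau>) ` A i) \<omega>))"

end

(*
  Only second moments are needed.  The process L has orthogonal increments with
  E|L_t - L_s|^2 = v |t - s|, and v > 0 because a nonzero Levy measure makes L_1 nondegenerate;
  so the integral of f vanishes almost surely only if f vanishes almost everywhere.
  Since L is real, conjugating the integrand conjugates the integral, and the Fourier transform of
  the indicator of -A is the conjugate of that of A.  Hence M([-1/2,1/2)) is almost surely real.
  Stationarity would make M([0,1)) real as well, but the Fourier transform of [0,1) is not real.
  Likewise M([-1,0)) is the conjugate of M([0,1)); being centered, the two can only be independent
  if M([0,1)) = 0, which again would be real.
*)
theory Submission
  imports Defs
begin

subsection \<open>Square-integrable functions\<close>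

text \<open>The variance formula is not immediate: moments are given at time 1 only and no path
  regularity is available, so additivity in time settles rational times only. Square integrability
  at another time t comes from splitting an increment over [0, n) at t into independent parts. The
  total variance is additive and nonnegative, which forces linearity; the mean has no sign, and it
  is the continuity in t of the prescribed characteristic function that makes it vanish. The second
  obstacle is that the integral is a version picked by \<open>SOME\<close>, about which nothing is
  known until some integral exists. For the transform of an interval this is made concrete: it is
  Lipschitz and decays like 1/|\<mu>|, hence is an L2 limit of step functions on finer and finer
  grids. The isometry uses the real inner product on the complex vectors. Only the total variance,
  the trace of the covariance matrix, enters it, so one positive number carries the whole
  nondegeneracy.\<close>

definition square_integrable :: "'a measure \<Rightarrow> ('a \<Rightarrow> 'b::euclidean_space) \<Rightarrow> bool" where
  "square_integrable M X \<longleftrightarrow> X \<in> borel_measurable M \<and> integrable M (\<lambda>x. (norm (X x))\<^sup>2)"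

lemma norm_add_square_le:
  fixes x y :: "'a::real_normed_vector"
  shows "(norm (x + y))\<^sup>2 \<le> 2 * (norm x)\<^sup>2 + 2 * (norm y)\<^sup>2"
proof -
  have "(norm (x + y))\<^sup>2 \<le> (norm x + norm y)\<^sup>2"
    by (intro power_mono norm_triangle_ineq norm_ge_zero)
  also have "\<dots> \<le> 2 * (norm x)\<^sup>2 + 2 * (norm y)\<^sup>2"
    using zero_le_power2[of "norm x - norm y"] by (simp add: power2_eq_square algebra_simps)
  finally show ?thesis .
qed

lemma square_integrable_measurable:
  "square_integrable M X \<Longrightarrow> X \<in> borel_measurable M"
  by (simp add: square_integrable_def)

lemma square_integrable_bound:
  assumes "square_integrable M X" "Y \<in> borel_measurable M" "AE x in M. norm (Y x) \<le> norm (X x)"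
  shows "square_integrable M Y"
proof -
  have "AE x in M. norm ((norm (Y x))\<^sup>2) \<le> norm ((norm (X x))\<^sup>2)"
    using assms(3) by eventually_elim (simp add: power_mono)
  moreover have "integrable M (\<lambda>x. (norm (X x))\<^sup>2)" "(\<lambda>x. (norm (Y x))\<^sup>2) \<in> borel_measurable M"
    using assms by (auto simp: square_integrable_def)
  ultimately have "integrable M (\<lambda>x. (norm (Y x))\<^sup>2)"
    using Bochner_Integration.integrable_bound by blast
  then show ?thesis using assms by (simp add: square_integrable_def)
qed

lemma square_integrable_add:
  fixes X Y :: "'a \<Rightarrow> 'b::euclidean_space"
  assumes "square_integrable M X" "square_integrable M Y"
  shows "square_integrable M (\<lambda>x. X x + Y x)"
proof -
  have [measurable]: "X \<in> borel_measurable M" "Y \<in> borel_measurable M"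
    using assms by (auto simp: square_integrable_def)
  have "integrable M (\<lambda>x. 2 * (norm (X x))\<^sup>2 + 2 * (norm (Y x))\<^sup>2)"
    using assms by (auto simp: square_integrable_def)
  then have "integrable M (\<lambda>x. (norm (X x + Y x))\<^sup>2)"
    by (rule Bochner_Integration.integrable_bound) (auto simp: norm_add_square_le intro: add_nonneg_nonneg)
  then show ?thesis by (simp add: square_integrable_def)
qed

lemma square_integrable_minus:
  "square_integrable M X \<Longrightarrow> square_integrable M (\<lambda>x. - X x)"
  by (auto simp: square_integrable_def)

lemma square_integrable_diff:
  fixes X Y :: "'a \<Rightarrow> 'b::euclidean_space"
  assumes "square_integrable M X" "square_integrable M Y"
  shows "square_integrable M (\<lambda>x. X x - Y x)"
  using square_integrable_add[OF assms(1) square_integrable_minus[OF assms(2)]] by simp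

lemma square_integrable_inner:
  fixes X Y :: "'a \<Rightarrow> 'b::euclidean_space"
  assumes "square_integrable M X" "square_integrable M Y"
  shows "integrable M (\<lambda>x. X x \<bullet> Y x)"
proof -
  have [measurable]: "X \<in> borel_measurable M" "Y \<in> borel_measurable M"
    using assms by (auto simp: square_integrable_def)
  have "integrable M (\<lambda>x. (norm (X x))\<^sup>2 + (norm (Y x))\<^sup>2)"
    using assms by (auto simp: square_integrable_def)
  moreover have "\<bar>X x \<bullet> Y x\<bar> \<le> (norm (X x))\<^sup>2 + (norm (Y x))\<^sup>2" for x
  proof -
    have "\<bar>X x \<bullet> Y x\<bar> \<le> norm (X x) * norm (Y x)" by (rule Cauchy_Schwarz_ineq2)
    also have "\<dots> \<le> (norm (X x))\<^sup>2 + (norm (Y x))\<^sup>2"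
      using sum_squares_bound[of "norm (X x)" "norm (Y x)"] zero_le_power2
        mult_nonneg_nonneg[OF norm_ge_zero[of "X x"] norm_ge_zero[of "Y x"]] by linarith
    finally show ?thesis .
  qed
  ultimately show ?thesis
    by (elim Bochner_Integration.integrable_bound) (auto intro: add_nonneg_nonneg)
qed

lemma (in finite_measure) square_integrable_imp_integrable:
  fixes X :: "'a \<Rightarrow> 'b::euclidean_space"
  assumes "square_integrable M X"
  shows "integrable M X"
proof -
  have "integrable M (\<lambda>x. 1 + (norm (X x))\<^sup>2)"
    using assms by (auto simp: square_integrable_def)
  moreover have "norm x \<le> 1 + (norm x)\<^sup>2" for x :: 'b
    using sum_squares_bound[of "norm x" 1] by (simp, smt (verit) norm_ge_zero)
  ultimately show ?thesis using assms
    by (elim Bochner_Integration.integrable_bound) (auto simp: square_integrable_def intro: add_nonneg_nonneg)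
qed

text \<open>Stands in for the L2 triangle inequality. It is applied only to obtain a limit 0 or a
  bound up to a constant, so the factor 2 does no harm; working in \<open>ennreal\<close> spares any
  integrability side condition.\<close>

lemma nn_integral_norm_add_square_le:
  fixes X Y :: "'a \<Rightarrow> 'b::euclidean_space"
  assumes [measurable]: "X \<in> borel_measurable M" "Y \<in> borel_measurable M"
  shows "(\<integral>\<^sup>+x. ennreal ((norm (X x + Y x))\<^sup>2) \<partial>M)
    \<le> 2 * (\<integral>\<^sup>+x. ennreal ((norm (X x))\<^sup>2) \<partial>M) + 2 * (\<integral>\<^sup>+x. ennreal ((norm (Y x))\<^sup>2) \<partial>M)"
proof -
  have "(\<integral>\<^sup>+x. ennreal ((norm (X x + Y x))\<^sup>2) \<partial>M)
      \<le> (\<integral>\<^sup>+x. 2 * ennreal ((norm (X x))\<^sup>2) + 2 * ennreal ((norm (Y x))\<^sup>2) \<partial>M)"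
  proof (rule nn_integral_mono)
    fix x
    have "ennreal ((norm (X x + Y x))\<^sup>2) \<le> ennreal (2 * (norm (X x))\<^sup>2 + 2 * (norm (Y x))\<^sup>2)"
      by (rule ennreal_leI) (rule norm_add_square_le)
    also have "\<dots> = 2 * ennreal ((norm (X x))\<^sup>2) + 2 * ennreal ((norm (Y x))\<^sup>2)"
      by (simp add: ennreal_mult ennreal_plus)
    finally show "ennreal ((norm (X x + Y x))\<^sup>2) \<le> 2 * ennreal ((norm (X x))\<^sup>2) + 2 * ennreal ((norm (Y x))\<^sup>2)" .
  qed
  also have "\<dots> = 2 * (\<integral>\<^sup>+x. ennreal ((norm (X x))\<^sup>2) \<partial>M) + 2 * (\<integral>\<^sup>+x. ennreal ((norm (Y x))\<^sup>2) \<partial>M)"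
    by (simp add: nn_integral_add nn_integral_cmult)
  finally show ?thesis .
qed

lemma square_integrable_iff_nn_integral:
  assumes "X \<in> borel_measurable M"
  shows "square_integrable M X \<longleftrightarrow> (\<integral>\<^sup>+x. ennreal ((norm (X x))\<^sup>2) \<partial>M) < \<infinity>"
  using assms by (simp add: square_integrable_def integrable_iff_bounded)

lemma nn_integral_norm_square_eq_0_iff:
  assumes [measurable]: "X \<in> borel_measurable M"
  shows "(\<integral>\<^sup>+x. ennreal ((norm (X x))\<^sup>2) \<partial>M) = 0 \<longleftrightarrow> (AE x in M. X x = 0)"
  by (subst nn_integral_0_iff_AE) auto

lemma tendsto_0_ennreal_mult:
  fixes f :: "'b \<Rightarrow> ennreal"
  assumes "(f \<longlongrightarrow> 0) F" "c < \<infinity>"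
  shows "((\<lambda>x. c * f x) \<longlongrightarrow> 0) F"
  using ennreal_tendsto_cmult[OF _ assms(1), of c] assms(2) by simp

lemma tendsto_0_ennreal_le:
  fixes f g :: "'b \<Rightarrow> ennreal"
  assumes "(g \<longlongrightarrow> 0) F" "\<And>x. f x \<le> g x"
  shows "(f \<longlongrightarrow> 0) F"
  by (rule tendsto_sandwich[OF _ _ tendsto_const assms(1)]) (use assms(2) in auto)

text \<open>Completeness of L2 for a sequence that is Cauchy at a geometric rate. Distances of order
  2^-n make the increments summable in L1, hence summable almost everywhere, which gives a pointwise
  limit; Fatou's lemma then passes the Cauchy bound to that limit.\<close>

lemma square_integrable_limit_exists:
  fixes Y :: "nat \<Rightarrow> 'a \<Rightarrow> 'b::euclidean_space"
  assumes "prob_space M"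
    and [measurable]: "\<And>n. Y n \<in> borel_measurable M"
    and fast: "\<And>m n. n \<le> m \<Longrightarrow> (\<integral>\<^sup>+x. ennreal ((norm (Y n x - Y m x))\<^sup>2) \<partial>M) \<le> ennreal (C * (1/4)^n)"
    and "C \<ge> 0"
  shows "\<exists>X. X \<in> borel_measurable M \<and> (\<forall>n. (\<integral>\<^sup>+x. ennreal ((norm (Y n x - X x))\<^sup>2) \<partial>M) \<le> ennreal (C * (1/4)^n))"
proof -
  interpret prob_space M by fact
  have step: "(\<integral>\<^sup>+x. ennreal (norm (Y (Suc n) x - Y n x)) \<partial>M) \<le> ennreal ((1 + C) * (1/2)^n)" for n
  proof -
    \<comment> \<open>In place of Cauchy--Schwarz: \<open>t \<le> a + t\<^sup>2 / a\<close> with \<open>a = 2^-n\<close>.\<close>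
    have "t \<le> (1/2)^n + 2^n * t\<^sup>2" if "t \<ge> 0" for t :: real
    proof (cases "t \<le> (1/2)^n")
      case True
      moreover have "0 \<le> 2^n * t\<^sup>2" by simp
      ultimately show ?thesis by linarith
    next
      case False
      then have "1 \<le> 2^n * t" by (simp add: power_one_over field_simps)
      then have "t * 1 \<le> t * (2^n * t)" using that by (intro mult_left_mono)
      then have "t \<le> 2^n * t\<^sup>2" by (simp add: power2_eq_square algebra_simps)
      also have "\<dots> \<le> (1/2)^n + 2^n * t\<^sup>2" by simp
      finally show ?thesis .
    qed
    then have "(\<integral>\<^sup>+x. ennreal (norm (Y (Suc n) x - Y n x)) \<partial>M)
        \<le> (\<integral>\<^sup>+x. ennreal ((1/2)^n) + ennreal (2^n) * ennreal ((norm (Y n x - Y (Suc n) x))\<^sup>2) \<partial>M)"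
      by (intro nn_integral_mono)
        (auto simp: norm_minus_commute simp flip: ennreal_plus ennreal_mult intro!: ennreal_leI)
    also have "\<dots> = ennreal ((1/2)^n) + ennreal (2^n) * (\<integral>\<^sup>+x. ennreal ((norm (Y n x - Y (Suc n) x))\<^sup>2) \<partial>M)"
      by (simp add: nn_integral_add nn_integral_cmult emeasure_space_1)
    also have "\<dots> \<le> ennreal ((1/2)^n) + ennreal (2^n) * ennreal (C * (1/4)^n)"
      by (intro add_left_mono mult_left_mono fast) auto
    also have "\<dots> = ennreal ((1/2)^n + 2^n * (C * (1/4)^n))"
      using \<open>C \<ge> 0\<close> by (simp add: ennreal_mult ennreal_plus)
    also have "(1/2)^n + 2^n * (C * (1/4)^n) = (1 + C) * (1/2)^n"
    proof -
      have "2^n * (1/4 :: real)^n = (1/2)^n" by (simp flip: power_mult_distrib)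
      then show ?thesis by (simp add: algebra_simps)
    qed
    finally show ?thesis .
  qed
  have "(\<integral>\<^sup>+x. (\<Sum>n. ennreal (norm (Y (Suc n) x - Y n x))) \<partial>M)
      = (\<Sum>n. \<integral>\<^sup>+x. ennreal (norm (Y (Suc n) x - Y n x)) \<partial>M)"
    by (rule nn_integral_suminf) simp
  also have "\<dots> \<le> (\<Sum>n. ennreal ((1 + C) * (1/2)^n))"
    by (intro suminf_le step) auto
  also have "\<dots> < \<infinity>"
  proof -
    have "(\<Sum>n. ennreal ((1 + C) * (1/2)^n)) \<noteq> top"
      using \<open>C \<ge> 0\<close> by (intro ennreal_suminf_neq_top summable_mult summable_geometric) auto
    then show ?thesis by (simp only: less_top infinity_ennreal_def)
  qed
  finally have "(\<integral>\<^sup>+x. (\<Sum>n. ennreal (norm (Y (Suc n) x - Y n x))) \<partial>M) \<noteq> \<infinity>" by simp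
  then have "AE x in M. (\<Sum>n. ennreal (norm (Y (Suc n) x - Y n x))) \<noteq> \<infinity>"
    by (intro nn_integral_PInf_AE) auto
  \<comment> \<open>Increments with summable norms have a convergent series, and its partial sums
    telescope to \<open>Y n x - Y 0 x\<close>.\<close>
  then have conv: "AE x in M. (\<lambda>n. Y n x) \<longlonglongrightarrow> lim (\<lambda>n. Y n x)"
  proof eventually_elim
    case (elim x)
    then have "summable (\<lambda>n. norm (Y (Suc n) x - Y n x))"
      by (intro summable_suminf_not_top) auto
    then have "summable (\<lambda>n. Y (Suc n) x - Y n x)" by (rule summable_norm_cancel)
    then have "convergent (\<lambda>n. \<Sum>k<n. Y (Suc k) x - Y k x)"
      by (simp add: summable_iff_convergent)
    then have "convergent (\<lambda>n. Y n x - Y 0 x)"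
      by (simp only: sum_lessThan_telescope[of "\<lambda>k. Y k x"])
    then have "convergent (\<lambda>n. (Y n x - Y 0 x) + Y 0 x)" by (intro convergent_add convergent_const)
    then show ?case by (simp add: convergent_LIMSEQ_iff)
  qed
  \<comment> \<open>Where the sequence diverges, \<open>lim\<close> returns an unspecified value;
    these points form a null set, and Fatou's lemma is applied after an almost everywhere
    rewriting.\<close>
  define X where "X = (\<lambda>x. lim (\<lambda>n. Y n x))"
  have [measurable]: "X \<in> borel_measurable M" unfolding X_def by measurable
  have "(\<integral>\<^sup>+x. ennreal ((norm (Y n x - X x))\<^sup>2) \<partial>M) \<le> ennreal (C * (1/4)^n)" for n
  proof -
    have "(\<integral>\<^sup>+x. ennreal ((norm (Y n x - X x))\<^sup>2) \<partial>M)
        = (\<integral>\<^sup>+x. liminf (\<lambda>m. ennreal ((norm (Y n x - Y m x))\<^sup>2)) \<partial>M)"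
    proof (rule nn_integral_cong_AE)
      show "AE x in M. ennreal ((norm (Y n x - X x))\<^sup>2) = liminf (\<lambda>m. ennreal ((norm (Y n x - Y m x))\<^sup>2))"
        using conv
      proof eventually_elim
        case (elim x)
        then have "(\<lambda>m. ennreal ((norm (Y n x - Y m x))\<^sup>2)) \<longlonglongrightarrow> ennreal ((norm (Y n x - X x))\<^sup>2)"
          unfolding X_def by (intro tendsto_intros)
        then show ?case by (intro lim_imp_Liminf[symmetric]) auto
      qed
    qed
    also have "\<dots> \<le> liminf (\<lambda>m. \<integral>\<^sup>+x. ennreal ((norm (Y n x - Y m x))\<^sup>2) \<partial>M)"
      by (rule nn_integral_liminf) simp
    also have "\<dots> \<le> ennreal (C * (1/4)^n)"
      using fast by (intro Liminf_le) (auto simp: eventually_sequentially)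
    finally show ?thesis .
  qed
  then show ?thesis by (intro exI[of _ X]) auto
qed

subsection \<open>Independence and second moments\<close>

lemma (in prob_space) indep_vars_imp_indep_var:
  assumes "indep_vars M' X I" "i \<in> I" "j \<in> I" "i \<noteq> j"
  shows "indep_var (M' i) (X i) (M' j) (X j)"
proof -
  have "indep_var (PiM {i} M') (\<lambda>\<omega>. restrict (\<lambda>i. X i \<omega>) {i}) (PiM {j} M') (\<lambda>\<omega>. restrict (\<lambda>i. X i \<omega>) {j})"
    using assms by (intro indep_var_restrict[OF assms(1)]) auto
  from indep_var_compose[OF this, of "\<lambda>f. f i" "M' i" "\<lambda>f. f j" "M' j"]
  show ?thesis by (simp add: comp_def)
qed

text \<open>By independence the second moment of the sum is an iterated integral over the two laws.
  Its finiteness makes X plus a constant square integrable for almost every value of Y taken as the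
  constant; one such value is enough, and the constant is then subtracted.\<close>

lemma (in prob_space) indep_var_square_integrable_summand:
  fixes X Y :: "'a \<Rightarrow> 'b::euclidean_space"
  assumes indep: "indep_var borel X borel Y"
    and sum: "square_integrable M (\<lambda>\<omega>. X \<omega> + Y \<omega>)"
  shows "square_integrable M X"
proof -
  have [measurable]: "X \<in> borel_measurable M" "Y \<in> borel_measurable M"
    using indep by (auto dest: indep_var_rv1 indep_var_rv2)
  let ?N = "\<lambda>x. ennreal ((norm x)\<^sup>2)" and ?A = "distr M borel X" and ?B = "distr M borel Y"
  interpret A: prob_space ?A by (rule prob_space_distr) simp
  interpret B: prob_space ?B by (rule prob_space_distr) simp
  have "(\<integral>\<^sup>+x. \<integral>\<^sup>+y. ?N (x + y) \<partial>?A \<partial>?B) = (\<integral>\<^sup>+p. ?N (fst p + snd p) \<partial>(?B \<Otimes>\<^sub>M ?A))"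
    by (subst A.nn_integral_fst[symmetric]) simp_all
  \<comment> \<open>With the law of X as inner integral, the product measure appears in the order
    opposite to the one in which independence provides it.\<close>
  also have "?B \<Otimes>\<^sub>M ?A = distr (?A \<Otimes>\<^sub>M ?B) (?B \<Otimes>\<^sub>M ?A) (\<lambda>(x, y). (y, x))"
  proof -
    interpret pair_sigma_finite ?A ?B ..
    interpret Q: pair_sigma_finite ?B ?A ..
    show ?thesis by (rule Q.distr_pair_swap)
  qed
  also have "(\<integral>\<^sup>+p. ?N (fst p + snd p) \<partial>\<dots>) = (\<integral>\<^sup>+p. ?N (fst p + snd p) \<partial>(?A \<Otimes>\<^sub>M ?B))"
    by (subst nn_integral_distr) (simp_all add: case_prod_beta add.commute)
  also have "?A \<Otimes>\<^sub>M ?B = distr M (borel \<Otimes>\<^sub>M borel) (\<lambda>\<omega>. (X \<omega>, Y \<omega>))"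
    using indep unfolding indep_var_distribution_eq by simp
  also have "(\<integral>\<^sup>+p. ?N (fst p + snd p) \<partial>\<dots>) = (\<integral>\<^sup>+\<omega>. ?N (X \<omega> + Y \<omega>) \<partial>M)"
    by (subst nn_integral_distr) simp_all
  also have "\<dots> < \<infinity>"
    using sum by (subst square_integrable_iff_nn_integral[symmetric]) simp_all
  finally have "AE x in ?B. (\<integral>\<^sup>+y. ?N (x + y) \<partial>?A) \<noteq> \<infinity>"
    by (intro nn_integral_PInf_AE) auto
  \<comment> \<open>An almost sure property on a probability space holds at some point.\<close>
  then obtain x where x: "(\<integral>\<^sup>+y. ?N (x + y) \<partial>?A) \<noteq> \<infinity>"
    using eventually_happens'[of "ae_filter ?B"] B.AE_False by (auto simp: trivial_limit_def)
  then have "(\<integral>\<^sup>+\<omega>. ?N (x + X \<omega>) \<partial>M) < \<infinity>"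
    by (simp add: nn_integral_distr less_top)
  then have "square_integrable M (\<lambda>\<omega>. x + X \<omega>)"
    by (subst square_integrable_iff_nn_integral) simp_all
  moreover have "square_integrable M (\<lambda>\<omega>. - x)" by (simp add: square_integrable_def)
  ultimately show ?thesis using square_integrable_add by fastforce
qed

lemma (in prob_space) indep_var_expectation_inner:
  fixes X Y :: "'a \<Rightarrow> 'b::euclidean_space"
  assumes indep: "indep_var borel X borel Y" and X: "square_integrable M X" and Y: "square_integrable M Y"
  shows "expectation (\<lambda>\<omega>. X \<omega> \<bullet> Y \<omega>) = expectation X \<bullet> expectation Y"
proof -
  have iX: "integrable M X" and iY: "integrable M Y"
    using X Y by (auto intro: square_integrable_imp_integrable)
  have indep_b: "indep_var borel (\<lambda>\<omega>. X \<omega> \<bullet> b) borel (\<lambda>\<omega>. Y \<omega> \<bullet> b)" for b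
    using indep_var_compose[OF indep, of "\<lambda>x. x \<bullet> b" borel "\<lambda>x. x \<bullet> b" borel] by (simp add: comp_def)
  have "expectation (\<lambda>\<omega>. X \<omega> \<bullet> Y \<omega>) = expectation (\<lambda>\<omega>. \<Sum>b\<in>Basis. (X \<omega> \<bullet> b) * (Y \<omega> \<bullet> b))"
    by (subst euclidean_inner) simp
  also have "\<dots> = (\<Sum>b\<in>Basis. expectation (\<lambda>\<omega>. (X \<omega> \<bullet> b) * (Y \<omega> \<bullet> b)))"
    using iX iY by (intro Bochner_Integration.integral_sum indep_var_integrable[OF indep_b]) auto
  also have "\<dots> = (\<Sum>b\<in>Basis. (expectation X \<bullet> b) * (expectation Y \<bullet> b))"
    using iX iY by (intro sum.cong refl) (simp add: indep_var_lebesgue_integral[OF indep_b])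
  also have "\<dots> = expectation X \<bullet> expectation Y" by (rule euclidean_inner[symmetric])
  finally show ?thesis .
qed

lemma (in prob_space) expectation_norm_square_le:
  assumes "square_integrable M X"
  shows "(expectation (\<lambda>\<omega>. norm (X \<omega>)))\<^sup>2 \<le> expectation (\<lambda>\<omega>. (norm (X \<omega>))\<^sup>2)"
proof -
  have "0 \<le> variance (\<lambda>\<omega>. norm (X \<omega>))" by (rule Bochner_Integration.integral_nonneg) simp
  also have "\<dots> = expectation (\<lambda>\<omega>. (norm (X \<omega>))\<^sup>2) - (expectation (\<lambda>\<omega>. norm (X \<omega>)))\<^sup>2"
    using assms square_integrable_imp_integrable[OF assms]
    by (intro variance_eq) (auto simp: square_integrable_def)
  finally show ?thesis by simp
qed

text \<open>Cauchy's functional equation, with nonnegativity as the regularity condition. Writing n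
  t as an integer plus a fractional part r gives n (f t - t f 1) = f r - r f 1. Nonnegativity makes
  f monotone, so both terms on the right lie between 0 and f 1; a bound that is uniform in n forces
  f t = t f 1.\<close>

lemma nonneg_additive_imp_linear:
  fixes f :: "real \<Rightarrow> real"
  assumes add: "\<And>s t. 0 \<le> s \<Longrightarrow> 0 \<le> t \<Longrightarrow> f (s + t) = f s + f t"
    and nonneg: "\<And>t. 0 \<le> t \<Longrightarrow> 0 \<le> f t" and "0 \<le> t"
  shows "f t = t * f 1"
proof -
  have nat: "f (real n * x) = real n * f x" if "0 \<le> x" for n x
  proof (induction n)
    case 0
    then show ?case using add[of 0 0] by simp
  next
    case (Suc n)
    then show ?case using add[of x "real n * x"] that by (simp add: algebra_simps)
  qed
  have f1: "0 \<le> f 1" by (rule nonneg) simp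
  have bound: "\<bar>real n * (f t - t * f 1)\<bar> \<le> f 1" for n
  proof -
    let ?k = "nat \<lfloor>real n * t\<rfloor>" and ?r = "frac (real n * t)"
    have nt: "0 \<le> real n * t" using assms(3) by simp
    then have k: "real ?k = of_int \<lfloor>real n * t\<rfloor>" by simp
    have split: "real n * t = real ?k + ?r" unfolding k by (simp add: frac_def)
    have r: "0 \<le> ?r" "?r \<le> 1" by (simp_all add: frac_lt_1 less_imp_le)
    have "real n * f t = f (real ?k + ?r)"
      using nat[OF assms(3), of n] split by simp
    also have "\<dots> = real ?k * f 1 + f ?r"
      using add[of "real ?k" ?r] nat[of 1 ?k] r by simp
    finally have "real n * f t - real n * t * f 1 = f ?r - ?r * f 1"
      by (subst split) (simp add: algebra_simps)
    moreover have "f 1 = f ?r + f (1 - ?r)" using add[of ?r "1 - ?r"] r by simp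
    then have "0 \<le> f ?r" "f ?r \<le> f 1" using nonneg[of ?r] nonneg[of "1 - ?r"] r by auto
    moreover have "0 \<le> ?r * f 1" "?r * f 1 \<le> f 1"
      using r f1 by (auto intro: mult_left_le_one_le)
    moreover have "real n * (f t - t * f 1) = real n * f t - real n * t * f 1" by (simp add: algebra_simps)
    ultimately show ?thesis unfolding abs_le_iff by linarith
  qed
  have "f t - t * f 1 = 0"
  proof (rule ccontr)
    assume "f t - t * f 1 \<noteq> 0"
    then obtain n where "f 1 < real n * \<bar>f t - t * f 1\<bar>"
      using reals_Archimedean3[of "\<bar>f t - t * f 1\<bar>"] by auto
    with bound[of n] show False by (simp add: abs_mult)
  qed
  then show ?thesis by simp
qed

subsection \<open>Step functions\<close>

lemma step_fun_Nil [simp]: "step_fun [] = (\<lambda>\<mu>. 0)"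
  by (simp add: step_fun_def fun_eq_iff)

lemma step_fun_Cons: "step_fun ((c, a, b) # xs) = (\<lambda>\<mu>. c * indicator {a..<b} \<mu> + step_fun xs \<mu>)"
  by (simp add: step_fun_def fun_eq_iff)

text \<open>The summand of \<open>step_integral\<close> as an operator, so that its real-linearity
  in \<open>x\<close> can be used.\<close>

definition complex_scale :: "complex \<Rightarrow> real ^ 'd \<Rightarrow> complex ^ 'd" where
  "complex_scale c x = (\<chi> j. c * of_real (x $ j))"

lemma bounded_linear_complex_scale: "bounded_linear (complex_scale c)"
  unfolding linear_conv_bounded_linear[symmetric]
  by (rule linearI)
    (simp_all add: complex_scale_def vec_eq_iff distrib_left scaleR_conv_of_real[where 'a=complex])

text \<open>The inner product here is the real one, the real part of the Hermitian form. Since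
  \<open>x\<close> and \<open>y\<close> have real coordinates, it splits into a factor for the
  coefficients and one for the vectors; this is what lets the isometry pass from increments to
  complex step functions.\<close>

lemma inner_complex_scale: "complex_scale c x \<bullet> complex_scale c' y = (c \<bullet> c') * (x \<bullet> y)"
proof -
  have "complex_scale c x \<bullet> complex_scale c' y = (\<Sum>j\<in>UNIV. (c \<bullet> c') * (x $ j * y $ j))"
    unfolding complex_scale_def inner_vec_def
    by (rule sum.cong) (simp_all add: inner_complex_def algebra_simps)
  then show ?thesis by (simp add: inner_vec_def sum_distrib_left)
qed

lemma norm_complex_scale: "norm (complex_scale c x) = cmod c * norm x"
  by (simp add: norm_eq_sqrt_inner inner_complex_scale real_sqrt_mult)

lemma step_integral_Nil [simp]: "step_integral L [] = (\<lambda>\<omega>. 0)"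
  by (simp add: step_integral_def fun_eq_iff)

lemma step_integral_Cons:
  "step_integral L ((c, a, b) # xs) =
    (\<lambda>\<omega>. complex_scale c (L b \<omega> - L a \<omega>) + step_integral L xs \<omega>)"
  by (simp add: step_integral_def complex_scale_def fun_eq_iff)

lemma step_repr_Nil [simp]: "step_repr []"
  by (simp add: step_repr_def)

lemma step_repr_Cons [simp]: "step_repr ((c, a, b) # xs) \<longleftrightarrow> a < b \<and> step_repr xs"
  by (auto simp: step_repr_def)

text \<open>Intervals in a list may overlap, so a difference is a concatenation and no common
  refinement is required.\<close>

definition step_diff ::
  "(complex \<times> real \<times> real) list \<Rightarrow> (complex \<times> real \<times> real) list \<Rightarrow> (complex \<times> real \<times> real) list" where
  "step_diff xs ys = xs @ map (\<lambda>(c, a, b). (- c, a, b)) ys"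

definition step_cnj :: "(complex \<times> real \<times> real) list \<Rightarrow> (complex \<times> real \<times> real) list" where
  "step_cnj xs = map (\<lambda>(c, a, b). (cnj c, a, b)) xs"

definition vec_cnj :: "complex ^ 'd \<Rightarrow> complex ^ 'd" where
  "vec_cnj x = (\<chi> j. cnj (x $ j))"

lemma step_repr_step_diff: "step_repr xs \<Longrightarrow> step_repr ys \<Longrightarrow> step_repr (step_diff xs ys)"
  by (fastforce simp: step_repr_def step_diff_def)

lemma step_repr_step_cnj: "step_repr xs \<Longrightarrow> step_repr (step_cnj xs)"
  by (fastforce simp: step_repr_def step_cnj_def)

lemma step_fun_step_diff: "step_fun (step_diff xs ys) \<mu> = step_fun xs \<mu> - step_fun ys \<mu>"
proof -
  have "step_fun (map (\<lambda>(c, a, b). (- c, a, b)) ys) \<mu> = - step_fun ys \<mu>"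
    by (induction ys) (auto simp: step_fun_def)
  then show ?thesis by (simp add: step_diff_def step_fun_def)
qed

lemma step_integral_step_diff:
  "step_integral L (step_diff xs ys) \<omega> = step_integral L xs \<omega> - step_integral L ys \<omega>"
proof -
  have "step_integral L (map (\<lambda>(c, a, b). (- c, a, b)) ys) \<omega> = - step_integral L ys \<omega>"
    by (induction ys) (auto simp: step_integral_def vec_eq_iff)
  then show ?thesis by (simp add: step_diff_def step_integral_def)
qed

lemma step_fun_step_cnj: "step_fun (step_cnj xs) \<mu> = cnj (step_fun xs \<mu>)"
  by (induction xs) (auto simp: step_fun_def step_cnj_def indicator_def)

lemma step_integral_step_cnj: "step_integral L (step_cnj xs) \<omega> = vec_cnj (step_integral L xs \<omega>)"
  by (induction xs) (auto simp: step_integral_def step_cnj_def vec_cnj_def vec_eq_iff)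

lemma vec_cnj_diff: "vec_cnj (x - y) = vec_cnj x - vec_cnj y"
  by (simp add: vec_cnj_def vec_eq_iff)

lemma norm_vec_cnj [simp]: "norm (vec_cnj x) = norm x"
  by (simp add: vec_cnj_def norm_vec_def)

lemma linear_vec_cnj: "linear vec_cnj"
  by (rule linearI) (simp_all add: vec_cnj_def vec_eq_iff)

lemma borel_measurable_vec_cnj [measurable]: "vec_cnj \<in> borel_measurable borel"
  by (intro borel_measurable_continuous_onI linear_continuous_on linear_conv_bounded_linear[THEN iffD1]
      linear_vec_cnj)

lemma borel_measurable_step_fun [measurable]: "step_fun xs \<in> borel_measurable borel"
  by (induction xs) (auto simp: step_fun_Cons split: prod.splits)

lemma square_integrable_indicator_Ico:
  "square_integrable lborel (\<lambda>\<mu>. c * indicator {a..<b :: real} \<mu> :: complex)"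
proof -
  have "(\<lambda>\<mu>. (norm (c * indicator {a..<b} \<mu>))\<^sup>2) = (\<lambda>\<mu>. indicator {a..<b} \<mu> *\<^sub>R (cmod c)\<^sup>2)"
    by (auto simp: indicator_def fun_eq_iff)
  moreover have "integrable lborel (\<lambda>\<mu>. indicator {a..<b} \<mu> *\<^sub>R (cmod c)\<^sup>2)"
    by (cases "a \<le> b") (auto intro!: integrable_scaleR_left integrable_real_indicator)
  ultimately show ?thesis by (simp add: square_integrable_def)
qed

lemma square_integrable_step_fun: "square_integrable lborel (step_fun xs)"
proof (induction xs)
  case Nil
  then show ?case by (simp add: square_integrable_def)
next
  case (Cons x xs)
  then show ?case
    by (cases x) (auto simp: step_fun_Cons intro!: square_integrable_add square_integrable_indicator_Ico)
qed

text \<open>The second-order structure on which the integral rests. Orthogonality over disjoint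
  intervals is not listed, since polarization extracts it from the variance formula. Positivity of
  \<open>v\<close> is what makes the isometry injective.\<close>

locale orthogonal_increments = prob_space P
  for P :: "'a measure" +
  fixes L :: "real \<Rightarrow> 'a \<Rightarrow> real ^ 'd" and v :: real
  assumes measurable_L [measurable]: "\<And>t. L t \<in> borel_measurable P"
    and v_pos: "v > 0"
    and square_integrable_increment: "\<And>s t. square_integrable P (\<lambda>\<omega>. L t \<omega> - L s \<omega>)"
    and expectation_increment: "\<And>s t. expectation (\<lambda>\<omega>. L t \<omega> - L s \<omega>) = 0"
    and variance_increment: "\<And>s t. expectation (\<lambda>\<omega>. (norm (L t \<omega> - L s \<omega>))\<^sup>2) = v * \<bar>t - s\<bar>"
begin

section \<open>Isometry for step functions\<close>

lemma square_integrable_scaled_increment: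
  "square_integrable P (\<lambda>\<omega>. complex_scale c (L b \<omega> - L a \<omega>))"
proof -
  have "complex_scale c \<in> borel_measurable borel"
    by (intro borel_measurable_continuous_onI linear_continuous_on bounded_linear_complex_scale)
  from measurable_compose[OF _ this, of "\<lambda>\<omega>. L b \<omega> - L a \<omega>"] show ?thesis
    using square_integrable_increment
    by (simp add: square_integrable_def norm_complex_scale power_mult_distrib)
qed

lemma square_integrable_step_integral: "square_integrable P (step_integral L xs)"
proof (induction xs)
  case Nil
  then show ?case by (simp add: square_integrable_def)
next
  case (Cons x xs)
  then show ?case
    by (cases x) (simp only: step_integral_Cons square_integrable_add square_integrable_scaled_increment)
qed

lemma borel_measurable_step_integral [measurable]: "step_integral L xs \<in> borel_measurable P"
  by (rule square_integrable_measurable) (rule square_integrable_step_integral)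

text \<open>Polarization expresses the inner product of two increments through squared increments
  between their four endpoints, whose expectations are known.\<close>

lemma expectation_inner_increments:
  assumes "a < b" "c < d"
  shows "expectation (\<lambda>\<omega>. (L b \<omega> - L a \<omega>) \<bullet> (L d \<omega> - L c \<omega>)) = v * measure lborel ({a..<b} \<inter> {c..<d})"
proof -
  have polarization: "(y - x) \<bullet> (w - z) =
      ((norm (y - z))\<^sup>2 + (norm (x - w))\<^sup>2 - (norm (y - w))\<^sup>2 - (norm (x - z))\<^sup>2) / 2"
    for x y z w :: "real ^ 'd"
    by (simp add: power2_norm_eq_inner inner_diff inner_commute)
  have I: "integrable P (\<lambda>\<omega>. (norm (L t \<omega> - L s \<omega>))\<^sup>2)" for s t
    using square_integrable_increment by (simp add: square_integrable_def)
  have "expectation (\<lambda>\<omega>. (L b \<omega> - L a \<omega>) \<bullet> (L d \<omega> - L c \<omega>))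
      = (v * \<bar>b - c\<bar> + v * \<bar>a - d\<bar> - v * \<bar>b - d\<bar> - v * \<bar>a - c\<bar>) / 2"
    unfolding polarization by (simp add: I variance_increment)
  also have "\<dots> = v * ((\<bar>b - c\<bar> + \<bar>a - d\<bar> - \<bar>b - d\<bar> - \<bar>a - c\<bar>) / 2)"
    by (simp add: algebra_simps)
  \<comment> \<open>This combination of distances is the length of the overlap; the case distinction
    is whether the two intervals meet.\<close>
  also have "(\<bar>b - c\<bar> + \<bar>a - d\<bar> - \<bar>b - d\<bar> - \<bar>a - c\<bar>) / 2 = measure lborel ({a..<b} \<inter> {c..<d})"
    using assms by (cases "max a c \<le> min b d") (auto simp: max_def min_def abs_if split: if_splits)
  finally show ?thesis .
qed

lemma expectation_inner_scaled_increments: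
  assumes "a < b" "a' < b'"
  shows "expectation (\<lambda>\<omega>. complex_scale c (L b \<omega> - L a \<omega>) \<bullet> complex_scale c' (L b' \<omega> - L a' \<omega>))
    = v * (LINT \<mu>|lborel. (c * indicator {a..<b} \<mu>) \<bullet> (c' * indicator {a'..<b'} \<mu>))"
proof -
  have *: "(c * indicator {a..<b} \<mu>) \<bullet> (c' * indicator {a'..<b'} \<mu>)
      = (c \<bullet> c') * indicator ({a..<b} \<inter> {a'..<b'}) \<mu>" for \<mu> :: real
    by (auto simp: indicator_def)
  show ?thesis
    unfolding * inner_complex_scale using expectation_inner_increments[OF assms] by simp
qed

text \<open>Both sides are bilinear in the lists, so two nested inductions reduce the claim to a
  pair of intervals, which may overlap in any way.\<close>

lemma expectation_inner_step_integral:
  assumes "step_repr xs" "step_repr ys"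
  shows "expectation (\<lambda>\<omega>. step_integral L xs \<omega> \<bullet> step_integral L ys \<omega>)
    = v * (LINT \<mu>|lborel. step_fun xs \<mu> \<bullet> step_fun ys \<mu>)"
  using assms(1)
proof (induction xs)
  case Nil
  then show ?case by simp
next
  case (Cons x xs)
  obtain c a b where x: "x = (c, a, b)" by (cases x)
  have ab: "a < b" "step_repr xs" using Cons.prems by (auto simp: x)
  have single: "expectation (\<lambda>\<omega>. complex_scale c (L b \<omega> - L a \<omega>) \<bullet> step_integral L ys \<omega>)
      = v * (LINT \<mu>|lborel. (c * indicator {a..<b} \<mu>) \<bullet> step_fun ys \<mu>)"
    using assms(2)
  proof (induction ys)
    case Nil
    then show ?case by simp
  next
    case (Cons y ys)
    obtain c' a' b' where y: "y = (c', a', b')" by (cases y)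
    have ab': "a' < b'" "step_repr ys" using Cons.prems by (auto simp: y)
    show ?case
      unfolding y step_integral_Cons step_fun_Cons inner_add_right
      using expectation_inner_scaled_increments[OF ab(1) ab'(1), of c c'] Cons.IH[OF ab'(2)]
      by (simp add: Bochner_Integration.integral_add square_integrable_inner square_integrable_scaled_increment
          square_integrable_step_integral square_integrable_indicator_Ico square_integrable_step_fun
          distrib_left)
  qed
  show ?case
    unfolding x step_integral_Cons step_fun_Cons inner_add_left
    using single Cons.IH[OF ab(2)]
    by (simp add: Bochner_Integration.integral_add square_integrable_inner square_integrable_scaled_increment
          square_integrable_step_integral square_integrable_indicator_Ico square_integrable_step_fun
          distrib_left)
qed

lemma step_isometry:
  assumes "step_repr xs"
  shows "(\<integral>\<^sup>+\<omega>. ennreal ((norm (step_integral L xs \<omega>))\<^sup>2) \<partial>P)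
    = ennreal v * (\<integral>\<^sup>+\<mu>. ennreal ((cmod (step_fun xs \<mu>))\<^sup>2) \<partial>lborel)"
proof -
  have "(\<integral>\<^sup>+\<omega>. ennreal ((norm (step_integral L xs \<omega>))\<^sup>2) \<partial>P)
      = ennreal (expectation (\<lambda>\<omega>. (norm (step_integral L xs \<omega>))\<^sup>2))"
    using square_integrable_step_integral[of xs]
    by (intro nn_integral_eq_integral) (auto simp: square_integrable_def)
  also have "expectation (\<lambda>\<omega>. (norm (step_integral L xs \<omega>))\<^sup>2)
      = v * (LINT \<mu>|lborel. (cmod (step_fun xs \<mu>))\<^sup>2)"
    using expectation_inner_step_integral[OF assms assms] by (simp add: power2_norm_eq_inner)
  also have "ennreal \<dots> = ennreal v * ennreal (LINT \<mu>|lborel. (cmod (step_fun xs \<mu>))\<^sup>2)"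
    using v_pos by (simp add: ennreal_mult)
  also have "ennreal (LINT \<mu>|lborel. (cmod (step_fun xs \<mu>))\<^sup>2)
      = (\<integral>\<^sup>+\<mu>. ennreal ((cmod (step_fun xs \<mu>))\<^sup>2) \<partial>lborel)"
    using square_integrable_step_fun[of xs]
    by (intro nn_integral_eq_integral[symmetric]) (auto simp: square_integrable_def)
  finally show ?thesis .
qed

lemma step_isometry_diff:
  assumes "step_repr xs" "step_repr ys"
  shows "(\<integral>\<^sup>+\<omega>. ennreal ((norm (step_integral L xs \<omega> - step_integral L ys \<omega>))\<^sup>2) \<partial>P)
    = ennreal v * (\<integral>\<^sup>+\<mu>. ennreal ((cmod (step_fun xs \<mu> - step_fun ys \<mu>))\<^sup>2) \<partial>lborel)"
  using step_isometry[OF step_repr_step_diff[OF assms]]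
  by (simp add: step_integral_step_diff step_fun_step_diff)

lemma expectation_step_integral: "expectation (step_integral L xs) = 0"
proof (induction xs)
  case Nil
  then show ?case by simp
next
  case (Cons x xs)
  obtain c a b where x: "x = (c, a, b)" by (cases x)
  have "expectation (\<lambda>\<omega>. complex_scale c (L b \<omega> - L a \<omega>)) = complex_scale c (expectation (\<lambda>\<omega>. L b \<omega> - L a \<omega>))"
    by (intro integral_bounded_linear bounded_linear_complex_scale square_integrable_imp_integrable square_integrable_increment)
  also have "\<dots> = 0" unfolding expectation_increment by (simp add: complex_scale_def vec_eq_iff)
  finally have "expectation (\<lambda>\<omega>. complex_scale c (L b \<omega> - L a \<omega>)) = 0" .
  with Cons show ?case
    unfolding x step_integral_Cons
    by (subst Bochner_Integration.integral_add)
      (auto intro!: square_integrable_imp_integrable square_integrable_step_integral square_integrable_scaled_increment)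
qed

section \<open>Integrals as L2 limits: comparison, mean, existence\<close>

lemma has_L2_integral_iff:
  "has_L2_integral P L f X \<longleftrightarrow> square_integrable lborel f \<and> square_integrable P X \<and>
    (\<exists>xs. (\<forall>n. step_repr (xs n)) \<and>
      (\<lambda>n. \<integral>\<^sup>+\<mu>. ennreal ((cmod (step_fun (xs n) \<mu> - f \<mu>))\<^sup>2) \<partial>lborel) \<longlonglongrightarrow> 0 \<and>
      (\<lambda>n. \<integral>\<^sup>+\<omega>. ennreal ((norm (step_integral L (xs n) \<omega> - X \<omega>))\<^sup>2) \<partial>P) \<longlonglongrightarrow> 0)"
  unfolding has_L2_integral_def square_integrable_def by (simp only: conj_assoc)

lemma has_L2_integral_diff:
  assumes "has_L2_integral P L f X" "has_L2_integral P L g Y"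
  shows "has_L2_integral P L (\<lambda>\<mu>. f \<mu> - g \<mu>) (\<lambda>\<omega>. X \<omega> - Y \<omega>)"
proof -
  obtain xs where xs: "\<And>n. step_repr (xs n)"
      "(\<lambda>n. \<integral>\<^sup>+\<mu>. ennreal ((cmod (step_fun (xs n) \<mu> - f \<mu>))\<^sup>2) \<partial>lborel) \<longlonglongrightarrow> 0"
      "(\<lambda>n. \<integral>\<^sup>+\<omega>. ennreal ((norm (step_integral L (xs n) \<omega> - X \<omega>))\<^sup>2) \<partial>P) \<longlonglongrightarrow> 0"
    using assms(1) unfolding has_L2_integral_iff by blast
  obtain ys where ys: "\<And>n. step_repr (ys n)"
      "(\<lambda>n. \<integral>\<^sup>+\<mu>. ennreal ((cmod (step_fun (ys n) \<mu> - g \<mu>))\<^sup>2) \<partial>lborel) \<longlonglongrightarrow> 0"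
      "(\<lambda>n. \<integral>\<^sup>+\<omega>. ennreal ((norm (step_integral L (ys n) \<omega> - Y \<omega>))\<^sup>2) \<partial>P) \<longlonglongrightarrow> 0"
    using assms(2) unfolding has_L2_integral_iff by blast
  have [measurable]: "f \<in> borel_measurable borel" "g \<in> borel_measurable borel"
      "X \<in> borel_measurable P" "Y \<in> borel_measurable P"
    using assms by (auto simp: has_L2_integral_def)
  have lim: "(\<lambda>n. 2 * a n + 2 * b n) \<longlonglongrightarrow> 0" if "a \<longlonglongrightarrow> 0" "b \<longlonglongrightarrow> 0" for a b :: "nat \<Rightarrow> ennreal"
    using tendsto_add[OF tendsto_0_ennreal_mult[OF that(1), of 2] tendsto_0_ennreal_mult[OF that(2), of 2]]
    by (simp add: less_top[symmetric])
  have "(\<lambda>n. \<integral>\<^sup>+\<mu>. ennreal ((cmod (step_fun (step_diff (xs n) (ys n)) \<mu> - (f \<mu> - g \<mu>)))\<^sup>2) \<partial>lborel) \<longlonglongrightarrow> 0"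
  proof (rule tendsto_0_ennreal_le[OF lim[OF xs(2) ys(2)]])
    fix n
    have "(\<integral>\<^sup>+\<mu>. ennreal ((cmod (step_fun (step_diff (xs n) (ys n)) \<mu> - (f \<mu> - g \<mu>)))\<^sup>2) \<partial>lborel)
      = (\<integral>\<^sup>+\<mu>. ennreal ((cmod ((step_fun (xs n) \<mu> - f \<mu>) + (g \<mu> - step_fun (ys n) \<mu>)))\<^sup>2) \<partial>lborel)"
      by (simp add: step_fun_step_diff algebra_simps)
    also have "\<dots> \<le> 2 * (\<integral>\<^sup>+\<mu>. ennreal ((cmod (step_fun (xs n) \<mu> - f \<mu>))\<^sup>2) \<partial>lborel)
        + 2 * (\<integral>\<^sup>+\<mu>. ennreal ((cmod (g \<mu> - step_fun (ys n) \<mu>))\<^sup>2) \<partial>lborel)"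
      by (rule nn_integral_norm_add_square_le) auto
    finally show "(\<integral>\<^sup>+\<mu>. ennreal ((cmod (step_fun (step_diff (xs n) (ys n)) \<mu> - (f \<mu> - g \<mu>)))\<^sup>2) \<partial>lborel)
        \<le> 2 * (\<integral>\<^sup>+\<mu>. ennreal ((cmod (step_fun (xs n) \<mu> - f \<mu>))\<^sup>2) \<partial>lborel)
        + 2 * (\<integral>\<^sup>+\<mu>. ennreal ((cmod (step_fun (ys n) \<mu> - g \<mu>))\<^sup>2) \<partial>lborel)"
      by (simp add: norm_minus_commute)
  qed
  moreover have "(\<lambda>n. \<integral>\<^sup>+\<omega>. ennreal ((norm (step_integral L (step_diff (xs n) (ys n)) \<omega> - (X \<omega> - Y \<omega>)))\<^sup>2) \<partial>P) \<longlonglongrightarrow> 0"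
  proof (rule tendsto_0_ennreal_le[OF lim[OF xs(3) ys(3)]])
    fix n
    have "(\<integral>\<^sup>+\<omega>. ennreal ((norm (step_integral L (step_diff (xs n) (ys n)) \<omega> - (X \<omega> - Y \<omega>)))\<^sup>2) \<partial>P)
      = (\<integral>\<^sup>+\<omega>. ennreal ((norm ((step_integral L (xs n) \<omega> - X \<omega>) + (Y \<omega> - step_integral L (ys n) \<omega>)))\<^sup>2) \<partial>P)"
      by (simp add: step_integral_step_diff algebra_simps)
    also have "\<dots> \<le> 2 * (\<integral>\<^sup>+\<omega>. ennreal ((norm (step_integral L (xs n) \<omega> - X \<omega>))\<^sup>2) \<partial>P)
        + 2 * (\<integral>\<^sup>+\<omega>. ennreal ((norm (Y \<omega> - step_integral L (ys n) \<omega>))\<^sup>2) \<partial>P)"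
      by (rule nn_integral_norm_add_square_le) auto
    finally show "(\<integral>\<^sup>+\<omega>. ennreal ((norm (step_integral L (step_diff (xs n) (ys n)) \<omega> - (X \<omega> - Y \<omega>)))\<^sup>2) \<partial>P)
        \<le> 2 * (\<integral>\<^sup>+\<omega>. ennreal ((norm (step_integral L (xs n) \<omega> - X \<omega>))\<^sup>2) \<partial>P)
        + 2 * (\<integral>\<^sup>+\<omega>. ennreal ((norm (step_integral L (ys n) \<omega> - Y \<omega>))\<^sup>2) \<partial>P)"
      by (simp add: norm_minus_commute)
  qed
  moreover have "square_integrable lborel (\<lambda>\<mu>. f \<mu> - g \<mu>)" "square_integrable P (\<lambda>\<omega>. X \<omega> - Y \<omega>)"
    using assms by (auto simp: has_L2_integral_iff intro!: square_integrable_diff)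
  moreover have "\<forall>n. step_repr (step_diff (xs n) (ys n))"
    using xs(1) ys(1) by (simp add: step_repr_step_diff)
  ultimately show ?thesis
    unfolding has_L2_integral_iff
    by (intro conjI exI[of _ "\<lambda>n. step_diff (xs n) (ys n)"]) assumption+
qed

text \<open>Conjugate the coefficients of the approximating lists: conjugation preserves norms on
  both sides, so neither error term changes.\<close>

lemma has_L2_integral_cnj:
  assumes "has_L2_integral P L f X"
  shows "has_L2_integral P L (\<lambda>\<mu>. cnj (f \<mu>)) (\<lambda>\<omega>. vec_cnj (X \<omega>))"
proof -
  obtain xs where xs: "\<And>n. step_repr (xs n)"
      "(\<lambda>n. \<integral>\<^sup>+\<mu>. ennreal ((cmod (step_fun (xs n) \<mu> - f \<mu>))\<^sup>2) \<partial>lborel) \<longlonglongrightarrow> 0"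
      "(\<lambda>n. \<integral>\<^sup>+\<omega>. ennreal ((norm (step_integral L (xs n) \<omega> - X \<omega>))\<^sup>2) \<partial>P) \<longlonglongrightarrow> 0"
    using assms(1) unfolding has_L2_integral_iff by blast
  have [measurable]: "f \<in> borel_measurable borel" "X \<in> borel_measurable P"
    using assms by (auto simp: has_L2_integral_def)
  have "(\<lambda>\<mu>. cnj (f \<mu>)) \<in> borel_measurable borel"
    by (rule measurable_compose[OF \<open>f \<in> _\<close>]) (intro borel_measurable_continuous_onI continuous_intros)
  then have "square_integrable lborel (\<lambda>\<mu>. cnj (f \<mu>))" "square_integrable P (\<lambda>\<omega>. vec_cnj (X \<omega>))"
    using assms by (auto simp: has_L2_integral_iff square_integrable_def)
  moreover have "\<forall>n. step_repr (step_cnj (xs n))"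
    using xs(1) by (simp add: step_repr_step_cnj)
  moreover have "cmod (step_fun (step_cnj (xs n)) \<mu> - cnj (f \<mu>)) = cmod (step_fun (xs n) \<mu> - f \<mu>)" for n \<mu>
    by (simp add: step_fun_step_cnj flip: complex_cnj_diff)
  moreover have "norm (step_integral L (step_cnj (xs n)) \<omega> - vec_cnj (X \<omega>)) = norm (step_integral L (xs n) \<omega> - X \<omega>)" for n \<omega>
    by (simp add: step_integral_step_cnj flip: vec_cnj_diff)
  ultimately show ?thesis
    unfolding has_L2_integral_iff
    by (intro conjI exI[of _ "\<lambda>n. step_cnj (xs n)"]) (simp_all add: xs)
qed

text \<open>Vanishing of a limit means that the L2 norms of its approximants tend to 0. On the two
  sides these norms are proportional by the step isometry, with a positive finite factor, so the
  isometry need not be extended to the limits themselves.\<close>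

lemma has_L2_integral_eq_0_iff:
  assumes "has_L2_integral P L f X"
  shows "(AE \<omega> in P. X \<omega> = 0) \<longleftrightarrow> (AE \<mu> in lborel. f \<mu> = 0)"
proof -
  obtain xs where xs: "\<And>n. step_repr (xs n)"
      "(\<lambda>n. \<integral>\<^sup>+\<mu>. ennreal ((cmod (step_fun (xs n) \<mu> - f \<mu>))\<^sup>2) \<partial>lborel) \<longlonglongrightarrow> 0"
      "(\<lambda>n. \<integral>\<^sup>+\<omega>. ennreal ((norm (step_integral L (xs n) \<omega> - X \<omega>))\<^sup>2) \<partial>P) \<longlonglongrightarrow> 0"
    using assms unfolding has_L2_integral_iff by blast
  have f [measurable]: "f \<in> borel_measurable lborel" and X [measurable]: "X \<in> borel_measurable P"
    using assms by (auto simp: has_L2_integral_def)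
  let ?F = "\<lambda>n. \<integral>\<^sup>+\<mu>. ennreal ((cmod (step_fun (xs n) \<mu>))\<^sup>2) \<partial>lborel"
  let ?S = "\<lambda>n. \<integral>\<^sup>+\<omega>. ennreal ((norm (step_integral L (xs n) \<omega>))\<^sup>2) \<partial>P"
  have SF: "?S = (\<lambda>n. ennreal v * ?F n)"
    using step_isometry[OF xs(1)] by auto
  \<comment> \<open>Kept general in the measure and the value space because it is used once on the
    probability space and once on the real line.\<close>
  have vanish: "(AE x in M. g x = 0) \<longleftrightarrow> (\<lambda>n. \<integral>\<^sup>+x. ennreal ((norm (s n x))\<^sup>2) \<partial>M) \<longlonglongrightarrow> 0"
    if [measurable]: "g \<in> borel_measurable M" "\<And>n. s n \<in> borel_measurable M"
      and lim: "(\<lambda>n. \<integral>\<^sup>+x. ennreal ((norm (s n x - g x))\<^sup>2) \<partial>M) \<longlonglongrightarrow> 0"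
    for M :: "'x measure" and g :: "'x \<Rightarrow> 'y::euclidean_space" and s :: "nat \<Rightarrow> 'x \<Rightarrow> 'y"
  proof
    assume "AE x in M. g x = 0"
    then have "(\<integral>\<^sup>+x. ennreal ((norm (s n x - g x))\<^sup>2) \<partial>M) = (\<integral>\<^sup>+x. ennreal ((norm (s n x))\<^sup>2) \<partial>M)" for n
      by (intro nn_integral_cong_AE) auto
    with lim show "(\<lambda>n. \<integral>\<^sup>+x. ennreal ((norm (s n x))\<^sup>2) \<partial>M) \<longlonglongrightarrow> 0" by simp
  next
    assume "(\<lambda>n. \<integral>\<^sup>+x. ennreal ((norm (s n x))\<^sup>2) \<partial>M) \<longlonglongrightarrow> 0"
    then have "(\<lambda>n. 2 * (\<integral>\<^sup>+x. ennreal ((norm (s n x))\<^sup>2) \<partial>M) + 2 * (\<integral>\<^sup>+x. ennreal ((norm (s n x - g x))\<^sup>2) \<partial>M)) \<longlonglongrightarrow> 0"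
      using tendsto_add[OF tendsto_0_ennreal_mult[of _ _ 2] tendsto_0_ennreal_mult[OF lim, of 2]]
      by (simp add: less_top[symmetric])
    moreover have "(\<integral>\<^sup>+x. ennreal ((norm (g x))\<^sup>2) \<partial>M) \<le>
        2 * (\<integral>\<^sup>+x. ennreal ((norm (s n x))\<^sup>2) \<partial>M) + 2 * (\<integral>\<^sup>+x. ennreal ((norm (s n x - g x))\<^sup>2) \<partial>M)" for n
      using nn_integral_norm_add_square_le[of "s n" M "\<lambda>x. g x - s n x"] by (simp add: norm_minus_commute)
    ultimately have "(\<lambda>n. \<integral>\<^sup>+x. ennreal ((norm (g x))\<^sup>2) \<partial>M) \<longlonglongrightarrow> 0"
      by (rule tendsto_0_ennreal_le)
    then have "(\<integral>\<^sup>+x. ennreal ((norm (g x))\<^sup>2) \<partial>M) = 0"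
      by (simp add: LIMSEQ_const_iff)
    then show "AE x in M. g x = 0"
      by (simp add: nn_integral_norm_square_eq_0_iff)
  qed
  have "?S \<longlonglongrightarrow> 0 \<longleftrightarrow> ?F \<longlonglongrightarrow> 0"
  proof
    assume "?F \<longlonglongrightarrow> 0"
    then show "?S \<longlonglongrightarrow> 0" unfolding SF by (rule tendsto_0_ennreal_mult) simp
  next
    assume "?S \<longlonglongrightarrow> 0"
    then have "(\<lambda>n. ennreal (1 / v) * ?S n) \<longlonglongrightarrow> 0" by (rule tendsto_0_ennreal_mult) simp
    also have "(\<lambda>n. ennreal (1 / v) * ?S n) = ?F"
    proof
      fix n
      have "ennreal (1 / v) * ennreal v = 1" using v_pos by (simp flip: ennreal_mult)
      then show "ennreal (1 / v) * ?S n = ?F n"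
        unfolding fun_cong[OF SF] by (simp only: mult.assoc[symmetric] mult_1)
    qed
    finally show "?F \<longlonglongrightarrow> 0" .
  qed
  moreover have "(AE \<omega> in P. X \<omega> = 0) \<longleftrightarrow> ?S \<longlonglongrightarrow> 0"
    by (rule vanish) (use xs(3) in auto)
  moreover have "(AE \<mu> in lborel. f \<mu> = 0) \<longleftrightarrow> ?F \<longlonglongrightarrow> 0"
    by (rule vanish) (use xs(2) in auto)
  ultimately show ?thesis by simp
qed

text \<open>One direction is uniqueness of the integral up to null sets, the other its injectivity.
  The proof of the theorem uses both: the first transports the conjugation symmetry from transforms
  to integrals, the second carries realness back to the transform.\<close>

lemma has_L2_integral_AE_eq_iff:
  assumes "has_L2_integral P L f X" "has_L2_integral P L g Y"
  shows "(AE \<omega> in P. X \<omega> = Y \<omega>) \<longleftrightarrow> (AE \<mu> in lborel. f \<mu> = g \<mu>)"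
  using has_L2_integral_eq_0_iff[OF has_L2_integral_diff[OF assms]] by simp

text \<open>Step integrals are centered, and the mean is continuous in L2.\<close>

lemma expectation_has_L2_integral:
  assumes "has_L2_integral P L f X"
  shows "expectation X = 0"
proof -
  obtain xs where xs: "\<And>n. step_repr (xs n)"
      "(\<lambda>n. \<integral>\<^sup>+\<omega>. ennreal ((norm (step_integral L (xs n) \<omega> - X \<omega>))\<^sup>2) \<partial>P) \<longlonglongrightarrow> 0"
    using assms unfolding has_L2_integral_iff by blast
  have X: "square_integrable P X" using assms by (simp add: has_L2_integral_iff)
  have le: "(norm (expectation X))\<^sup>2 \<le> expectation (\<lambda>\<omega>. (norm (step_integral L (xs n) \<omega> - X \<omega>))\<^sup>2)" for n
  proof -
    let ?D = "\<lambda>\<omega>. step_integral L (xs n) \<omega> - X \<omega>"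
    have D: "square_integrable P ?D" by (intro square_integrable_diff X square_integrable_step_integral)
    have "expectation ?D = - expectation X"
      using expectation_step_integral[of "xs n"]
      by (simp add: square_integrable_imp_integrable X square_integrable_step_integral)
    then have "(norm (expectation X))\<^sup>2 = (norm (expectation ?D))\<^sup>2" by simp
    also have "\<dots> \<le> (expectation (\<lambda>\<omega>. norm (?D \<omega>)))\<^sup>2"
      by (intro power_mono integral_norm_bound) auto
    also have "\<dots> \<le> expectation (\<lambda>\<omega>. (norm (?D \<omega>))\<^sup>2)"
      by (rule expectation_norm_square_le[OF D])
    finally show ?thesis .
  qed
  have "(\<lambda>n. ennreal ((norm (expectation X))\<^sup>2)) \<longlonglongrightarrow> 0"
  proof (rule tendsto_0_ennreal_le[OF xs(2)])
    fix n
    have "(\<integral>\<^sup>+\<omega>. ennreal ((norm (step_integral L (xs n) \<omega> - X \<omega>))\<^sup>2) \<partial>P)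
        = ennreal (expectation (\<lambda>\<omega>. (norm (step_integral L (xs n) \<omega> - X \<omega>))\<^sup>2))"
      using square_integrable_diff[OF square_integrable_step_integral X]
      by (intro nn_integral_eq_integral) (auto simp: square_integrable_def)
    then show "ennreal ((norm (expectation X))\<^sup>2)
        \<le> (\<integral>\<^sup>+\<omega>. ennreal ((norm (step_integral L (xs n) \<omega> - X \<omega>))\<^sup>2) \<partial>P)"
      using le[of n] by (simp add: ennreal_leI)
  qed
  then show ?thesis by (simp add: LIMSEQ_const_iff)
qed

text \<open>The isometry turns approximation of the integrand into a Cauchy sequence of step
  integrals. The constant 4 v consists of 2 + 2 from the weak triangle inequality and of the
  isometry factor.\<close>

lemma has_L2_integral_exists:
  assumes f: "square_integrable lborel f"
    and repr: "\<And>n. step_repr (xs n)"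
    and approx: "(\<lambda>n. \<integral>\<^sup>+\<mu>. ennreal ((cmod (step_fun (xs n) \<mu> - f \<mu>))\<^sup>2) \<partial>lborel) \<longlonglongrightarrow> 0"
  shows "\<exists>X. has_L2_integral P L f X"
proof -
  have [measurable]: "f \<in> borel_measurable lborel" using f by (simp add: square_integrable_def)
  \<comment> \<open>A subsequence with squared errors below (1/4)^n provides the geometric rate that
    the completeness lemma asks for.\<close>
  have "\<exists>k. (\<integral>\<^sup>+\<mu>. ennreal ((cmod (step_fun (xs k) \<mu> - f \<mu>))\<^sup>2) \<partial>lborel) < ennreal ((1/4)^n)" for n
    using order_tendstoD(2)[OF approx, of "ennreal ((1/4)^n)"]
    by (auto simp: eventually_sequentially)
  then obtain k where k: "\<And>n. (\<integral>\<^sup>+\<mu>. ennreal ((cmod (step_fun (xs (k n)) \<mu> - f \<mu>))\<^sup>2) \<partial>lborel) < ennreal ((1/4)^n)"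
    by metis
  define ys where "ys n = xs (k n)" for n
  have ys: "step_repr (ys n)" for n using repr by (simp add: ys_def)
  have close: "(\<integral>\<^sup>+\<mu>. ennreal ((cmod (step_fun (ys n) \<mu> - f \<mu>))\<^sup>2) \<partial>lborel) \<le> ennreal ((1/4)^n)" for n
    using k[of n] by (simp add: ys_def)
  have fast: "(\<integral>\<^sup>+\<omega>. ennreal ((norm (step_integral L (ys n) \<omega> - step_integral L (ys m) \<omega>))\<^sup>2) \<partial>P)
      \<le> ennreal (4 * v * (1/4)^n)" if "n \<le> m" for m n
  proof -
    have "(\<integral>\<^sup>+\<mu>. ennreal ((cmod (step_fun (ys n) \<mu> - step_fun (ys m) \<mu>))\<^sup>2) \<partial>lborel)
        \<le> 2 * (\<integral>\<^sup>+\<mu>. ennreal ((cmod (step_fun (ys n) \<mu> - f \<mu>))\<^sup>2) \<partial>lborel)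
          + 2 * (\<integral>\<^sup>+\<mu>. ennreal ((cmod (step_fun (ys m) \<mu> - f \<mu>))\<^sup>2) \<partial>lborel)"
      using nn_integral_norm_add_square_le[of "\<lambda>\<mu>. step_fun (ys n) \<mu> - f \<mu>" lborel "\<lambda>\<mu>. f \<mu> - step_fun (ys m) \<mu>"]
      by (simp add: norm_minus_commute)
    also have "\<dots> \<le> 2 * ennreal ((1/4)^n) + 2 * ennreal ((1/4)^n)"
    proof (intro add_mono mult_left_mono)
      have "ennreal ((1/4)^m) \<le> ennreal ((1/4)^n)"
        using that by (intro ennreal_leI power_decreasing) auto
      with close[of m] show "(\<integral>\<^sup>+\<mu>. ennreal ((cmod (step_fun (ys m) \<mu> - f \<mu>))\<^sup>2) \<partial>lborel) \<le> ennreal ((1/4)^n)"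
        by (rule order_trans)
    qed (auto intro: close)
    also have "\<dots> = ennreal (4 * (1/4)^n)"
    proof -
      have "2 * ennreal r + 2 * ennreal r = ennreal (4 * r)" if "r \<ge> 0" for r
        using that by (simp add: ennreal_mult flip: distrib_right)
      then show ?thesis by simp
    qed
    finally have "ennreal v * (\<integral>\<^sup>+\<mu>. ennreal ((cmod (step_fun (ys n) \<mu> - step_fun (ys m) \<mu>))\<^sup>2) \<partial>lborel)
        \<le> ennreal v * ennreal (4 * (1/4)^n)"
      by (intro mult_left_mono) auto
    also have "\<dots> = ennreal (4 * v * (1/4)^n)"
      using v_pos by (simp add: mult_ac flip: ennreal_mult)
    finally show ?thesis by (simp add: step_isometry_diff ys)
  qed
  obtain X where X [measurable]: "X \<in> borel_measurable P"
    and lim: "\<And>n. (\<integral>\<^sup>+\<omega>. ennreal ((norm (step_integral L (ys n) \<omega> - X \<omega>))\<^sup>2) \<partial>P) \<le> ennreal (4 * v * (1/4)^n)"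
    using square_integrable_limit_exists[OF prob_space_axioms borel_measurable_step_integral fast] v_pos
    by auto
  have geom: "(\<lambda>n. ennreal (c * (1/4)^n)) \<longlonglongrightarrow> 0" for c
  proof -
    have "(\<lambda>n. c * (1/4 :: real)^n) \<longlonglongrightarrow> c * 0" by (intro tendsto_intros LIMSEQ_power_zero) auto
    then show ?thesis using tendsto_ennrealI by fastforce
  qed
  \<comment> \<open>The limit is written as a step integral minus an error that is finite by the
    bound for index 0.\<close>
  have "square_integrable P (\<lambda>\<omega>. step_integral L (ys 0) \<omega> - (step_integral L (ys 0) \<omega> - X \<omega>))"
  proof (rule square_integrable_diff[OF square_integrable_step_integral])
    show "square_integrable P (\<lambda>\<omega>. step_integral L (ys 0) \<omega> - X \<omega>)"
      using lim[of 0] by (subst square_integrable_iff_nn_integral) (auto simp: le_less_trans)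
  qed
  then have "square_integrable P X" by simp
  moreover have "(\<lambda>n. \<integral>\<^sup>+\<mu>. ennreal ((cmod (step_fun (ys n) \<mu> - f \<mu>))\<^sup>2) \<partial>lborel) \<longlonglongrightarrow> 0"
    using tendsto_0_ennreal_le[OF geom[of 1]] close by simp
  moreover have "(\<lambda>n. \<integral>\<^sup>+\<omega>. ennreal ((norm (step_integral L (ys n) \<omega> - X \<omega>))\<^sup>2) \<partial>P) \<longlonglongrightarrow> 0"
    by (rule tendsto_0_ennreal_le[OF geom lim])
  ultimately show ?thesis using f ys unfolding has_L2_integral_iff by blast
qed

end

subsection \<open>Fourier transforms of intervals\<close>

lemma norm_exp_ii_diff_le: "norm (exp (\<i> * of_real x) - exp (\<i> * of_real y)) \<le> \<bar>x - y\<bar>"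
proof -
  have "exp (\<i> * of_real x) - exp (\<i> * of_real y) = exp (\<i> * of_real y) * (exp (\<i> * of_real (x - y)) - 1)"
    by (simp add: algebra_simps flip: exp_add)
  then have "norm (exp (\<i> * of_real x) - exp (\<i> * of_real y)) = norm (exp (\<i> * of_real (x - y)) - 1)"
    by (simp add: norm_mult)
  also have "\<dots> \<le> \<bar>x - y\<bar>"
    using iexp_approx1[of "x - y" 0] by simp
  finally show ?thesis .
qed

lemma integrable_Ico_continuous:
  fixes f :: "real \<Rightarrow> complex"
  assumes "continuous_on UNIV f"
  shows "set_integrable lborel {a..<b} f"
  by (rule set_integrable_subset[of _ "{a..b}"])
    (auto intro!: borel_integrable_atLeastAtMost' continuous_on_subset[OF assms])

lemma fourier_indicator_Ico:
  assumes "a < b" "\<mu> \<noteq> 0"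
  shows "fourier_indicator {a..<b} \<mu> = of_real (1 / sqrt (2 * pi)) *
    ((exp (\<i> * of_real (- \<mu> * a)) - exp (\<i> * of_real (- \<mu> * b))) / (\<i> * of_real \<mu>))"
proof -
  let ?e = "\<lambda>x. exp (- \<i> * of_real \<mu> * of_real x)"
  let ?F = "\<lambda>x. - ?e x / (\<i> * of_real \<mu>)"
  have "(LINT x:{a..<b}|lborel. ?e x) = (LINT x|lborel. indicator {a..b} x *\<^sub>R ?e x)"
    unfolding set_lebesgue_integral_def
  proof (rule integral_cong_AE)
    have "AE x in lborel. x \<noteq> b" by (rule AE_lborel_singleton)
    then show "AE x in lborel. indicator {a..<b} x *\<^sub>R ?e x = indicator {a..b} x *\<^sub>R ?e x"
      by eventually_elim (auto simp: indicator_def)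
  qed auto
  also have "\<dots> = ?F b - ?F a"
  proof (rule integral_FTC_atLeastAtMost)
    show "(?F has_vector_derivative ?e x) (at x within {a..b})" for x
    proof -
      have "((\<lambda>z. - exp (- \<i> * of_real \<mu> * z) / (\<i> * of_real \<mu>)) has_field_derivative ?e x) (at (of_real x))"
        using assms by (auto intro!: derivative_eq_intros simp: field_simps)
      then show ?thesis
        by (rule has_vector_derivative_real_field)
    qed
  qed (use assms in \<open>auto intro!: continuous_intros\<close>)
  also have "\<dots> = (exp (\<i> * of_real (- \<mu> * a)) - exp (\<i> * of_real (- \<mu> * b))) / (\<i> * of_real \<mu>)"
    by (simp add: diff_divide_distrib mult.assoc)
  finally show ?thesis by (simp add: fourier_indicator_def)
qed

text \<open>Read off the closed form, hence the restriction to nonzero frequencies; the identity is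
  later used only almost everywhere.\<close>

lemma cnj_fourier_indicator_Ico:
  assumes "a < b" "\<mu> \<noteq> 0"
  shows "cnj (fourier_indicator {a..<b} \<mu>) = fourier_indicator {- b..<- a} \<mu>"
proof -
  have e: "cnj (exp (\<i> * of_real x)) = exp (\<i> * of_real (- x))" for x
    by (simp add: exp_cnj)
  have swap: "(x - y) / (- z) = (y - x) / z" for x y z :: complex
    by (metis minus_diff_eq minus_divide_divide)
  show ?thesis
    unfolding fourier_indicator_Ico[OF assms]
      fourier_indicator_Ico[OF neg_less_iff_less[THEN iffD2, OF assms(1)] assms(2)]
      complex_cnj_mult complex_cnj_diff complex_cnj_divide complex_cnj_complex_of_real complex_cnj_i e
      mult_minus_left[of \<i>] swap
    by simp
qed

text \<open>At frequency pi the exponentials at the endpoints are 1 and -1, so the quotient is 2 /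
  (\<i> pi), which is purely imaginary. One frequency is enough because the transform is
  continuous.\<close>

lemma fourier_indicator_Ico_pi: "Im (fourier_indicator {0..<1} pi) \<noteq> 0"
proof -
  have e: "exp (\<i> * of_real (- pi * 1)) = - 1" "exp (\<i> * of_real (- pi * 0)) = 1"
    by (simp_all add: exp_minus)
  have "fourier_indicator {0..<1} pi = of_real (1 / sqrt (2 * pi)) * ((1 - - 1) / (\<i> * of_real pi))"
    using fourier_indicator_Ico[of 0 1 pi] unfolding e by simp
  also have "(1 - - 1) / (\<i> * of_real pi) = of_real (- (2 / pi)) * \<i>"
    by (simp add: complex_eq_iff Re_divide Im_divide power2_eq_square)
  finally show ?thesis by simp
qed

text \<open>The kernel is Lipschitz in the frequency with constant |x|, and |x| is at most |a| + |b|
  on the bounded interval. The bound yields continuity and also controls the grid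
  approximation.\<close>

lemma lipschitz_fourier_indicator_Ico:
  assumes "a < b"
  shows "\<exists>K. \<forall>\<mu> \<mu>'. cmod (fourier_indicator {a..<b} \<mu> - fourier_indicator {a..<b} \<mu>') \<le> K * \<bar>\<mu> - \<mu>'\<bar>"
proof -
  let ?c = "1 / sqrt (2 * pi)" and ?K = "(\<bar>a\<bar> + \<bar>b\<bar>) * (b - a)"
  have c: "cmod (of_real ?c) = ?c" by (subst norm_of_real) simp
  have "cmod (fourier_indicator {a..<b} \<mu> - fourier_indicator {a..<b} \<mu>') \<le> ?c * ?K * \<bar>\<mu> - \<mu>'\<bar>" for \<mu> \<mu>'
  proof -
    let ?e = "\<lambda>\<mu> x. exp (- \<i> * of_real \<mu> * of_real x)"
    have I: "set_integrable lborel {a..<b} (?e \<mu>)" for \<mu>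
      by (intro integrable_Ico_continuous continuous_intros)
    have "cmod (fourier_indicator {a..<b} \<mu> - fourier_indicator {a..<b} \<mu>')
        = ?c * cmod (LINT x:{a..<b}|lborel. ?e \<mu> x - ?e \<mu>' x)"
      unfolding fourier_indicator_def set_integral_diff(2)[OF I I] right_diff_distrib[symmetric] norm_mult c
      by (rule refl)
    also have "\<dots> \<le> ?c * (LINT x:{a..<b}|lborel. cmod (?e \<mu> x - ?e \<mu>' x))"
      unfolding set_lebesgue_integral_def
      by (intro mult_left_mono order_trans[OF integral_norm_bound]) simp_all
    also have "\<dots> \<le> ?c * (LINT x:{a..<b}|lborel. (\<bar>a\<bar> + \<bar>b\<bar>) * \<bar>\<mu> - \<mu>'\<bar>)"
    proof (intro mult_left_mono set_integral_mono)
      show "set_integrable lborel {a..<b} (\<lambda>x. cmod (?e \<mu> x - ?e \<mu>' x))"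
        by (rule set_integrable_norm) (intro set_integral_diff I)
      show "set_integrable lborel {a..<b} (\<lambda>x. (\<bar>a\<bar> + \<bar>b\<bar>) * \<bar>\<mu> - \<mu>'\<bar>)"
        using assms unfolding set_integrable_def by simp
      fix x assume x: "x \<in> {a..<b}"
      have "cmod (?e \<mu> x - ?e \<mu>' x) \<le> \<bar>- \<mu> * x - - \<mu>' * x\<bar>"
        using norm_exp_ii_diff_le[of "- \<mu> * x" "- \<mu>' * x"] by (simp add: mult.assoc)
      also have "\<dots> = \<bar>x\<bar> * \<bar>\<mu> - \<mu>'\<bar>"
        proof -
        have "- \<mu> * x - - \<mu>' * x = - (x * (\<mu> - \<mu>'))" by (simp add: algebra_simps)
        then show ?thesis by (simp only: abs_minus_cancel abs_mult)
      qed
      also have "\<dots> \<le> (\<bar>a\<bar> + \<bar>b\<bar>) * \<bar>\<mu> - \<mu>'\<bar>"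
        using x by (intro mult_right_mono) auto
      finally show "cmod (?e \<mu> x - ?e \<mu>' x) \<le> (\<bar>a\<bar> + \<bar>b\<bar>) * \<bar>\<mu> - \<mu>'\<bar>" .
    qed simp
    also have "\<dots> = ?c * ?K * \<bar>\<mu> - \<mu>'\<bar>"
      using assms by (simp add: set_lebesgue_integral_def)
    finally show ?thesis .
  qed
  then show ?thesis by blast
qed

lemma continuous_fourier_indicator_Ico:
  assumes "a < b"
  shows "continuous_on UNIV (fourier_indicator {a..<b})"
proof -
  obtain K where K: "\<And>\<mu> \<mu>'. cmod (fourier_indicator {a..<b} \<mu> - fourier_indicator {a..<b} \<mu>') \<le> K * \<bar>\<mu> - \<mu>'\<bar>"
    using lipschitz_fourier_indicator_Ico[OF assms] by blast
  have "0 \<le> K * \<bar>1 - 0\<bar>" by (rule order_trans[OF norm_ge_zero K])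
  then have "K-lipschitz_on UNIV (fourier_indicator {a..<b})"
    using K by (intro lipschitz_onI) (auto simp: dist_norm)
  then show ?thesis by (rule lipschitz_on_continuous_on)
qed

text \<open>In place of Plancherel: the transform is bounded by a multiple of b - a, and its closed
  form decays like 2/|\<mu>|. Adding the squares of the two bounds dominates the squared modulus by
  a multiple of 1/(1 + \<mu>^2).\<close>

lemma square_integrable_fourier_indicator_Ico:
  assumes "a < b"
  shows "square_integrable lborel (fourier_indicator {a..<b})"
proof -
  let ?c = "1 / sqrt (2 * pi)" and ?f = "fourier_indicator {a..<b}"
  have [measurable]: "?f \<in> borel_measurable borel"
    by (intro borel_measurable_continuous_onI continuous_fourier_indicator_Ico assms)
  have c: "cmod (of_real ?c) = ?c" by (subst norm_of_real) simp
  have bound: "cmod (?f \<mu>) \<le> ?c * (b - a)" for \<mu>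
  proof -
    have "cmod (?f \<mu>) \<le> ?c * (LINT x:{a..<b}|lborel. cmod (exp (- \<i> * of_real \<mu> * of_real x)))"
      unfolding fourier_indicator_def set_lebesgue_integral_def norm_mult c
      by (intro mult_left_mono order_trans[OF integral_norm_bound]) simp_all
    also have "\<dots> = ?c * (LINT x:{a..<b}|lborel. 1)"
      by (simp add: norm_exp_eq_Re)
    also have "\<dots> = ?c * (b - a)" using assms by (simp add: set_lebesgue_integral_def)
    finally show ?thesis .
  qed
  have decay: "\<bar>\<mu>\<bar> * cmod (?f \<mu>) \<le> ?c * 2" for \<mu>
  proof (cases "\<mu> = 0")
    case False
    have "cmod (exp (\<i> * of_real (- \<mu> * a)) - exp (\<i> * of_real (- \<mu> * b))) \<le> 1 + 1"
      by (rule order_trans[OF norm_triangle_ineq4]) (simp add: norm_exp_eq_Re)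
    then show ?thesis
      using False unfolding fourier_indicator_Ico[OF assms False] norm_mult norm_divide c
      by (simp add: divide_right_mono)
  qed simp
  have "integrable lborel (\<lambda>\<mu> :: real. (?c\<^sup>2 * ((b - a)\<^sup>2 + 4)) * inverse (1 + \<mu>\<^sup>2))"
    using integrable_inverse_1_plus_square by (simp add: set_integrable_def einterval_def)
  moreover have "(cmod (?f \<mu>))\<^sup>2 \<le> (?c\<^sup>2 * ((b - a)\<^sup>2 + 4)) * inverse (1 + \<mu>\<^sup>2)" for \<mu>
  proof -
    have "(cmod (?f \<mu>))\<^sup>2 + (\<bar>\<mu>\<bar> * cmod (?f \<mu>))\<^sup>2 \<le> (?c * (b - a))\<^sup>2 + (?c * 2)\<^sup>2"
      using bound[of \<mu>] decay[of \<mu>] by (intro add_mono power_mono) auto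
    then have "(cmod (?f \<mu>))\<^sup>2 * (1 + \<mu>\<^sup>2) \<le> ?c\<^sup>2 * ((b - a)\<^sup>2 + 4)"
      by (simp only: power_mult_distrib power2_abs) (simp add: algebra_simps)
    moreover have "0 < 1 + \<mu>\<^sup>2" by (simp add: add_pos_nonneg)
    ultimately show ?thesis by (simp only: divide_inverse[symmetric] pos_le_divide_eq)
  qed
  ultimately have "integrable lborel (\<lambda>\<mu>. (cmod (?f \<mu>))\<^sup>2)"
    by (elim Bochner_Integration.integrable_bound) (auto intro!: mult_nonneg_nonneg)
  then show ?thesis by (simp add: square_integrable_def)
qed

section \<open>Step approximation of Lipschitz functions\<close>

text \<open>The mesh \<open>1 / m\<^sup>2\<close> is fine enough for the squared error of a Lipschitz function, summed over
  the growing window \<open>[-m, m)\<close>, to vanish.\<close>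

definition grid_steps :: "(real \<Rightarrow> complex) \<Rightarrow> nat \<Rightarrow> (complex \<times> real \<times> real) list" where
  "grid_steps f m = map (\<lambda>k. (f (of_int k / real m ^ 2), of_int k / real m ^ 2, (of_int k + 1) / real m ^ 2))
    (upto (- (int m ^ 3)) (int m ^ 3 - 1))"

lemma step_repr_grid_steps: "m > 0 \<Longrightarrow> step_repr (grid_steps f m)"
  by (auto simp: step_repr_def grid_steps_def divide_strict_right_mono)

text \<open>The indices from -m^3 to m^3 - 1 are those of the cells of length 1/m^2 that tile [-m,
  m), and the cell containing \<mu> has index \<open>\<lfloor>real m ^ 2 * \<mu>\<rfloor>\<close>;
  at most one summand survives.\<close>

lemma step_fun_grid_steps:
  assumes "m > 0"
  shows "step_fun (grid_steps f m) \<mu> =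
    (if - real m \<le> \<mu> \<and> \<mu> < real m then f (of_int \<lfloor>real m ^ 2 * \<mu>\<rfloor> / real m ^ 2) else 0)"
proof -
  let ?k = "\<lfloor>real m ^ 2 * \<mu>\<rfloor>"
  have m2: "real m ^ 2 > 0" using assms by simp
  have ind: "indicator {of_int k / real m ^ 2..<(of_int k + 1) / real m ^ 2} \<mu> = (if k = ?k then 1 else 0 :: complex)" for k
  proof -
    have "\<mu> \<in> {of_int k / real m ^ 2..<(of_int k + 1) / real m ^ 2}
        \<longleftrightarrow> of_int k \<le> real m ^ 2 * \<mu> \<and> real m ^ 2 * \<mu> < of_int k + 1"
      using m2 by (simp add: pos_divide_le_eq pos_less_divide_eq mult.commute)
    also have "\<dots> \<longleftrightarrow> k = ?k" by linarith
    finally show ?thesis by (simp add: indicator_def)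
  qed
  have "step_fun (grid_steps f m) \<mu>
      = (\<Sum>k\<in>{- (int m ^ 3)..int m ^ 3 - 1}. f (of_int k / real m ^ 2) * (if k = ?k then 1 else 0))"
    by (simp only: step_fun_def grid_steps_def map_map comp_def prod.case ind
        sum_list_distinct_conv_sum_set distinct_upto set_upto)
  also have "\<dots> = (if ?k \<in> {- (int m ^ 3)..int m ^ 3 - 1} then f (of_int ?k / real m ^ 2) else 0)"
    by (simp add: if_distrib cong: if_cong)
  also have "?k \<in> {- (int m ^ 3)..int m ^ 3 - 1} \<longleftrightarrow> - (real m ^ 3) \<le> real m ^ 2 * \<mu> \<and> real m ^ 2 * \<mu> < real m ^ 3"
    by (auto simp: le_floor_iff floor_less_iff)
  also have "\<dots> \<longleftrightarrow> - real m \<le> \<mu> \<and> \<mu> < real m"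
  proof -
    have "- (real m ^ 3) = real m ^ 2 * (- real m)" "real m ^ 3 = real m ^ 2 * real m"
      by (simp_all add: power2_eq_square power3_eq_cube)
    then show ?thesis using m2 by (simp only: mult_le_cancel_left_pos mult_less_cancel_left_pos)
  qed
  finally show ?thesis .
qed

text \<open>Inside the window the error is at most K/m^2, so its square integrates to at most 2 K^2
  / m^3. Outside, the error is the tail of f, which vanishes by dominated convergence.
  \<open>Suc n\<close> keeps the mesh defined.\<close>

lemma grid_steps_approx:
  assumes f: "square_integrable lborel f"
    and K: "\<And>x y. cmod (f x - f y) \<le> K * \<bar>x - y\<bar>"
  shows "(\<lambda>n. \<integral>\<^sup>+\<mu>. ennreal ((cmod (step_fun (grid_steps f (Suc n)) \<mu> - f \<mu>))\<^sup>2) \<partial>lborel) \<longlonglongrightarrow> 0"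
proof -
  have [measurable]: "f \<in> borel_measurable borel" using f by (simp add: square_integrable_def)
  have K0: "0 \<le> K" using order_trans[OF norm_ge_zero K[of 1 0]] by simp
  let ?I = "\<lambda>n. {- real (Suc n)..<real (Suc n)}"
  let ?tail = "\<lambda>n. \<integral>\<^sup>+\<mu>. ennreal ((cmod (f \<mu>))\<^sup>2) * indicator (- ?I n) \<mu> \<partial>lborel"
  have "(\<lambda>n. ?tail n) \<longlonglongrightarrow> (\<integral>\<^sup>+(\<mu>::real). 0 \<partial>lborel)"
  proof (rule nn_integral_dominated_convergence[where w = "\<lambda>\<mu>. ennreal ((cmod (f \<mu>))\<^sup>2)"])
    show "(\<integral>\<^sup>+\<mu>. ennreal ((cmod (f \<mu>))\<^sup>2) \<partial>lborel) < \<infinity>"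
      using f square_integrable_iff_nn_integral[of f lborel] by simp
    show "AE \<mu> in lborel. (\<lambda>n. ennreal ((cmod (f \<mu>))\<^sup>2) * indicator (- ?I n) \<mu>) \<longlonglongrightarrow> 0"
    proof (rule AE_I2)
      fix \<mu> :: real
      obtain N where N: "\<bar>\<mu>\<bar> < real N" using reals_Archimedean2 by blast
      have "\<forall>\<^sub>F n in sequentially. ennreal ((cmod (f \<mu>))\<^sup>2) * indicator (- ?I n) \<mu> = 0"
        using eventually_ge_at_top[of N] by eventually_elim (use N in \<open>auto simp: indicator_def\<close>)
      then show "(\<lambda>n. ennreal ((cmod (f \<mu>))\<^sup>2) * indicator (- ?I n) \<mu>) \<longlonglongrightarrow> 0"
        by (rule tendsto_eventually)
    qed
  qed (auto simp: indicator_def)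
  then have tail: "(\<lambda>n. ?tail n) \<longlonglongrightarrow> 0" by simp
  have le: "(\<integral>\<^sup>+\<mu>. ennreal ((cmod (step_fun (grid_steps f (Suc n)) \<mu> - f \<mu>))\<^sup>2) \<partial>lborel)
      \<le> ennreal (2 * K\<^sup>2 * inverse (real (Suc n)) ^ 3) + ?tail n" for n
  proof -
    define m where "m = real (Suc n)"
    have m: "m > 0" by (simp add: m_def)
    have "(\<integral>\<^sup>+\<mu>. ennreal ((cmod (step_fun (grid_steps f (Suc n)) \<mu> - f \<mu>))\<^sup>2) \<partial>lborel)
      \<le> (\<integral>\<^sup>+\<mu>. ennreal ((K / m ^ 2)\<^sup>2) * indicator (?I n) \<mu> + ennreal ((cmod (f \<mu>))\<^sup>2) * indicator (- ?I n) \<mu> \<partial>lborel)"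
    proof (rule nn_integral_mono)
      fix \<mu> :: real
      show "ennreal ((cmod (step_fun (grid_steps f (Suc n)) \<mu> - f \<mu>))\<^sup>2)
        \<le> ennreal ((K / m ^ 2)\<^sup>2) * indicator (?I n) \<mu> + ennreal ((cmod (f \<mu>))\<^sup>2) * indicator (- ?I n) \<mu>"
      proof (cases "\<mu> \<in> ?I n")
        case True
        let ?x = "of_int \<lfloor>m ^ 2 * \<mu>\<rfloor> / m ^ 2"
        have "\<bar>of_int \<lfloor>m ^ 2 * \<mu>\<rfloor> - m ^ 2 * \<mu>\<bar> \<le> 1" by linarith
        then have "\<bar>of_int \<lfloor>m ^ 2 * \<mu>\<rfloor> - m ^ 2 * \<mu>\<bar> / m ^ 2 \<le> 1 / m ^ 2"
          by (rule divide_right_mono) simp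
        also have "\<bar>of_int \<lfloor>m ^ 2 * \<mu>\<rfloor> - m ^ 2 * \<mu>\<bar> / m ^ 2 = \<bar>(of_int \<lfloor>m ^ 2 * \<mu>\<rfloor> - m ^ 2 * \<mu>) / m ^ 2\<bar>"
          by simp
        also have "(of_int \<lfloor>m ^ 2 * \<mu>\<rfloor> - m ^ 2 * \<mu>) / m ^ 2 = ?x - \<mu>"
          using m by (simp add: diff_divide_distrib)
        finally have "K * \<bar>?x - \<mu>\<bar> \<le> K * (1 / m ^ 2)" using K0 by (rule mult_left_mono)
        with K[of ?x \<mu>] have "cmod (f ?x - f \<mu>) \<le> K / m ^ 2" by simp
        then have "(cmod (f ?x - f \<mu>))\<^sup>2 \<le> (K / m ^ 2)\<^sup>2" by (rule power_mono) simp
        moreover have "step_fun (grid_steps f (Suc n)) \<mu> = f ?x"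
          using True by (simp add: step_fun_grid_steps m_def del: of_nat_Suc)
        ultimately show ?thesis using True by (simp add: ennreal_leI)
      next
        case False
        then have "step_fun (grid_steps f (Suc n)) \<mu> = 0"
          by (auto simp: step_fun_grid_steps simp del: of_nat_Suc)
        then show ?thesis using False by simp
      qed
    qed
    also have "\<dots> = ennreal ((K / m ^ 2)\<^sup>2) * emeasure lborel (?I n) + ?tail n"
      by (subst nn_integral_add) (simp_all add: nn_integral_cmult_indicator)
    also have "emeasure lborel (?I n) = ennreal (2 * m)"
      by (simp add: m_def)
    also have "ennreal ((K / m ^ 2)\<^sup>2) * ennreal (2 * m) = ennreal (2 * K\<^sup>2 * inverse m ^ 3)"
      using m by (simp add: ennreal_mult[symmetric] field_simps power2_eq_square power3_eq_cube)
    finally show ?thesis by (simp add: m_def)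
  qed
  have "(\<lambda>n. 2 * K\<^sup>2 * inverse (real (Suc n)) ^ 3) \<longlonglongrightarrow> 2 * K\<^sup>2 * 0 ^ 3"
    by (intro tendsto_intros LIMSEQ_inverse_real_of_nat)
  then have "(\<lambda>n. ennreal (2 * K\<^sup>2 * inverse (real (Suc n)) ^ 3)) \<longlonglongrightarrow> 0"
    using tendsto_ennrealI by fastforce
  from tendsto_add[OF this tail] have "(\<lambda>n. ennreal (2 * K\<^sup>2 * inverse (real (Suc n)) ^ 3) + ?tail n) \<longlonglongrightarrow> 0"
    by simp
  then show ?thesis
    by (rule tendsto_sandwich[OF _ _ tendsto_const, rotated 2]) (use le in auto)
qed

text \<open>A closed set of full Lebesgue measure is the whole line.\<close>

lemma AE_eq_imp_eq_continuous:
  fixes f g :: "real \<Rightarrow> 'b::real_normed_vector"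
  assumes "continuous_on UNIV f" "continuous_on UNIV g" "AE x in lborel. f x = g x"
  shows "f x = g x"
proof -
  have "closed {x. f x = g x}" using assms by (intro closed_Collect_eq)
  moreover have "AE x in lebesgue. x \<in> {x. f x = g x}"
    using AE_completion[OF assms(3)] by simp
  ultimately show ?thesis using mem_closed_if_AE_lebesgue by blast
qed

subsection \<open>Centered square-integrable Levy processes\<close>

locale centered_levy = prob_space P
  for P :: "'a measure" +
  fixes L :: "real \<Rightarrow> 'a \<Rightarrow> real ^ 'd" and \<gamma> :: "real ^ 'd" and S :: "real ^ 'd ^ 'd"
    and \<nu> :: "(real ^ 'd) measure"
  assumes levy: "two_sided_levy_process P L \<gamma> S \<nu>"
    and centered: "expectation (L 1) = 0"
    and second_moment: "integrable P (\<lambda>\<omega>. (norm (L 1 \<omega>))\<^sup>2)"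
    and nontrivial: "emeasure \<nu> UNIV \<noteq> 0"
begin

section \<open>Square integrability and variance at all times\<close>

lemma measurable_L [measurable]: "L t \<in> borel_measurable P"
  using levy by (simp add: two_sided_levy_process_def)

lemma L_0: "AE \<omega> in P. L 0 \<omega> = 0"
  using levy by (simp add: two_sided_levy_process_def)

text \<open>Stationarity moves the increment to start at time 0. The order of \<open>s\<close> and
  \<open>t\<close> is free, so this also reaches negative times.\<close>

lemma distr_increment: "distr P borel (\<lambda>\<omega>. L t \<omega> - L s \<omega>) = distr P borel (L (t - s))"
proof -
  have "distr P borel (\<lambda>\<omega>. L (t - s + s) \<omega> - L (0 + s) \<omega>) = distr P borel (\<lambda>\<omega>. L (t - s) \<omega> - L 0 \<omega>)"
    using levy unfolding two_sided_levy_process_def stationary_increments_def by blast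
  also have "\<dots> = distr P borel (L (t - s))"
    using L_0 by (intro distr_cong_AE) auto
  finally show ?thesis by simp
qed

lemma expectation_increment_cong:
  fixes g :: "real ^ 'd \<Rightarrow> 'b::{banach, second_countable_topology}"
  assumes [measurable]: "g \<in> borel_measurable borel"
  shows "expectation (\<lambda>\<omega>. g (L t \<omega> - L s \<omega>)) = expectation (\<lambda>\<omega>. g (L (t - s) \<omega>))"
  using arg_cong[OF distr_increment, of "\<lambda>M. integral\<^sup>L M g" t s] by (simp add: integral_distr)

lemma square_integrable_increment_iff:
  "square_integrable P (\<lambda>\<omega>. L t \<omega> - L s \<omega>) \<longleftrightarrow> square_integrable P (L (t - s))"
  using arg_cong[OF distr_increment, of "\<lambda>M. integrable M (\<lambda>x. (norm x)\<^sup>2)" t s]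
  by (simp add: square_integrable_def integrable_distr_eq)

lemma indep_increments:
  assumes "s < t" "t < u"
  shows "indep_var borel (\<lambda>\<omega>. L t \<omega> - L s \<omega>) borel (\<lambda>\<omega>. L u \<omega> - L t \<omega>)"
proof -
  \<comment> \<open>The three times as a sequence; the value beyond index 2 is a filler, since
    strict monotonicity is required on \<open>{..2}\<close> only.\<close>
  define T :: "nat \<Rightarrow> real" where "T i = (if i = 0 then s else if i = 1 then t else u)" for i
  have "strict_mono_on {..2} T"
    using assms by (auto simp: strict_mono_on_def T_def)
  then have "indep_vars (\<lambda>_. borel) (\<lambda>i \<omega>. L (T (Suc i)) \<omega> - L (T i) \<omega>) {..<2}"
    using levy unfolding two_sided_levy_process_def independent_increments_def by blast
  from indep_vars_imp_indep_var[OF this, of 0 1] show ?thesis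
    by (simp add: T_def)
qed

lemma square_integrable_0: "square_integrable P (L 0)"
proof -
  have "integrable P (\<lambda>\<omega>. (norm (L 0 \<omega>))\<^sup>2) \<longleftrightarrow> integrable P (\<lambda>\<omega>. 0 :: real)"
    using L_0 by (intro integrable_cong_AE) auto
  then show ?thesis by (simp add: square_integrable_def)
qed

lemma square_integrable_of_nat: "square_integrable P (L (real n))"
proof (induction n)
  case 0
  then show ?case using square_integrable_0 by simp
next
  case (Suc n)
  have "square_integrable P (\<lambda>\<omega>. L (real (Suc n)) \<omega> - L (real n) \<omega>)"
    unfolding square_integrable_increment_iff using second_moment by (simp add: square_integrable_def)
  from square_integrable_add[OF this Suc] show ?case by simp
qed

text \<open>At integer times L is a sum of increments distributed like L at time 1. A real t is
  placed below an integer n, and the increment over [0, n) splits at t into two independent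
  summands, each of which inherits the square integrability.\<close>

lemma square_integrable_nonneg:
  assumes "0 \<le> t"
  shows "square_integrable P (L t)"
proof (cases "t = 0")
  case False
  with assms have "0 < t" by simp
  obtain n where n: "t < real n" using reals_Archimedean2 by blast
  have "square_integrable P (\<lambda>\<omega>. (L t \<omega> - L 0 \<omega>) + (L (real n) \<omega> - L t \<omega>))"
    using square_integrable_diff[OF square_integrable_of_nat square_integrable_0] by simp
  from indep_var_square_integrable_summand[OF indep_increments[OF \<open>0 < t\<close> n] this]
  have "square_integrable P (\<lambda>\<omega>. L t \<omega> - L 0 \<omega>)" .
  then show ?thesis unfolding square_integrable_increment_iff by simp
qed (simp add: square_integrable_0)

lemma square_integrable_L: "square_integrable P (L t)"
proof (cases "0 \<le> t")
  case False
  then have "square_integrable P (\<lambda>\<omega>. L 0 \<omega> - L t \<omega>)"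
    unfolding square_integrable_increment_iff by (intro square_integrable_nonneg) simp
  from square_integrable_diff[OF square_integrable_0 this] show ?thesis by simp
qed (rule square_integrable_nonneg)

lemma integrable_L: "integrable P (L t)"
  by (rule square_integrable_imp_integrable) (rule square_integrable_L)

lemma expectation_add: "expectation (L (s + t)) = expectation (L s) + expectation (L t)"
proof -
  have "expectation (\<lambda>\<omega>. L (s + t) \<omega> - L s \<omega>) = expectation (L t)"
    using expectation_increment_cong[of "\<lambda>x. x" "s + t" s] by simp
  then show ?thesis by (simp add: integrable_L algebra_simps)
qed

lemma expectation_of_nat_mult: "expectation (L (real n * t)) = real n *\<^sub>R expectation (L t)"
proof (induction n)
  case 0
  have "expectation (L 0) = expectation (\<lambda>\<omega>. 0)" using L_0 by (intro integral_cong_AE) auto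
  then show ?case by simp
next
  case (Suc n)
  then show ?case using expectation_add[of t "real n * t"] by (simp add: algebra_simps)
qed

text \<open>The trace of the covariance matrix. It is centered at the mean because the mean is not
  yet known to vanish; that fact is itself derived from the linearity of
  \<open>total_var\<close>.\<close>

definition total_var :: "real \<Rightarrow> real" where
  "total_var t = expectation (\<lambda>\<omega>. (norm (L t \<omega> - expectation (L t)))\<^sup>2)"

lemma square_integrable_centered: "square_integrable P (\<lambda>\<omega>. L t \<omega> - c)"
  by (intro square_integrable_diff square_integrable_L) (simp add: square_integrable_def)

lemma total_var_add:
  assumes "0 \<le> s" "0 \<le> t"
  shows "total_var (s + t) = total_var s + total_var t"
proof -
  have total_var0: "total_var 0 = 0"
  proof -
    have "total_var 0 = expectation (\<lambda>\<omega>. 0)"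
      unfolding total_var_def using L_0 expectation_of_nat_mult[of 0 0] by (intro integral_cong_AE) auto
    then show ?thesis by simp
  qed
  \<comment> \<open>Independence of increments is stated for strictly increasing times, so empty
    increments are treated apart.\<close>
  consider "s = 0" | "t = 0" | "0 < s" "0 < t" using assms by fastforce
  then show ?thesis
  proof cases
    case 3
    have norm_add_square: "(norm (x + y))\<^sup>2 = (norm x)\<^sup>2 + (norm y)\<^sup>2 + 2 * (x \<bullet> y)" for x y :: "real ^ 'd"
      by (simp add: power2_norm_eq_inner inner_add inner_commute)
    let ?A = "\<lambda>\<omega>. L s \<omega> - expectation (L s)" and ?B = "\<lambda>\<omega>. (L (s + t) \<omega> - L s \<omega>) - expectation (L t)"
    have A: "square_integrable P ?A" by (rule square_integrable_centered)
    have B: "square_integrable P ?B"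
      by (intro square_integrable_diff square_integrable_L) (simp add: square_integrable_def)
    \<comment> \<open>Independence speaks of increments, so \<open>L s\<close> has to enter as
      \<open>L s \<omega> - L 0 \<omega>\<close>; the two agree almost surely.\<close>
    have "indep_var borel (\<lambda>\<omega>. L s \<omega> - L 0 \<omega>) borel (\<lambda>\<omega>. L (s + t) \<omega> - L s \<omega>)"
      using 3 by (intro indep_increments) auto
    from indep_var_compose[OF this, of "\<lambda>x. x - expectation (L s)" borel "\<lambda>x. x - expectation (L t)" borel]
    have "indep_var borel (\<lambda>\<omega>. L s \<omega> - L 0 \<omega> - expectation (L s)) borel ?B"
      by (simp add: comp_def)
    moreover have "square_integrable P (\<lambda>\<omega>. L s \<omega> - L 0 \<omega> - expectation (L s))"
      by (intro square_integrable_diff square_integrable_L) (simp add: square_integrable_def)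
    ultimately have "expectation (\<lambda>\<omega>. (L s \<omega> - L 0 \<omega> - expectation (L s)) \<bullet> ?B \<omega>)
        = expectation (\<lambda>\<omega>. L s \<omega> - L 0 \<omega> - expectation (L s)) \<bullet> expectation ?B"
      using B by (rule indep_var_expectation_inner)
    also have "expectation ?B = 0"
      using expectation_add[of s t] by (simp add: integrable_L prob_space)
    finally have "expectation (\<lambda>\<omega>. (L s \<omega> - L 0 \<omega> - expectation (L s)) \<bullet> ?B \<omega>) = 0" by simp
    moreover have "expectation (\<lambda>\<omega>. ?A \<omega> \<bullet> ?B \<omega>) = expectation (\<lambda>\<omega>. (L s \<omega> - L 0 \<omega> - expectation (L s)) \<bullet> ?B \<omega>)"
      using L_0 by (intro integral_cong_AE) auto
    ultimately have AB: "expectation (\<lambda>\<omega>. ?A \<omega> \<bullet> ?B \<omega>) = 0" by simp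
    have "total_var (s + t) = expectation (\<lambda>\<omega>. (norm (?A \<omega> + ?B \<omega>))\<^sup>2)"
      by (simp add: total_var_def expectation_add algebra_simps)
    also have "\<dots> = expectation (\<lambda>\<omega>. (norm (?A \<omega>))\<^sup>2 + (norm (?B \<omega>))\<^sup>2 + 2 * (?A \<omega> \<bullet> ?B \<omega>))"
      by (simp only: norm_add_square)
    also have "\<dots> = expectation (\<lambda>\<omega>. (norm (?A \<omega>))\<^sup>2) + expectation (\<lambda>\<omega>. (norm (?B \<omega>))\<^sup>2)
        + 2 * expectation (\<lambda>\<omega>. ?A \<omega> \<bullet> ?B \<omega>)"
      using A B square_integrable_inner[OF A B]
      by (subst Bochner_Integration.integral_add, simp_all add: square_integrable_def)+
    also have "expectation (\<lambda>\<omega>. (norm (?B \<omega>))\<^sup>2) = total_var t"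
      using expectation_increment_cong[of "\<lambda>x. (norm (x - expectation (L t)))\<^sup>2" "s + t" s]
      by (simp add: total_var_def)
    finally show ?thesis using AB by (simp add: total_var_def)
  qed (simp_all add: total_var0)
qed

lemma total_var_eq:
  assumes "0 \<le> t"
  shows "total_var t = t * total_var 1"
  by (rule nonneg_additive_imp_linear[OF total_var_add _ assms]) (auto simp: total_var_def)

section \<open>The mean at arbitrary times\<close>

lemma char_fun_nonneg:
  assumes "0 \<le> t"
  shows "expectation (\<lambda>\<omega>. exp (\<i> * of_real (z \<bullet> L t \<omega>))) = exp (of_real t * levy_exponent \<gamma> S \<nu> z)"
proof -
  have "expectation (\<lambda>\<omega>. exp (\<i> * of_real (z \<bullet> L t \<omega>))) = exp (of_real \<bar>t\<bar> * levy_exponent \<gamma> S \<nu> (sgn t *\<^sub>R z))"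
    using levy unfolding two_sided_levy_process_def by blast
  then show ?thesis using assms by (cases "t = 0") auto
qed

text \<open>A random vector with small variance has nearly the characteristic function of the point
  mass at its mean: the exponential is Lipschitz, and Jensen bounds the mean deviation by the root
  of the variance, which vanishes as t tends to 0.\<close>

lemma char_fun_near_phase:
  assumes "0 \<le> t"
  shows "cmod (exp (of_real t * levy_exponent \<gamma> S \<nu> z) - exp (\<i> * of_real (z \<bullet> expectation (L t))))
    \<le> norm z * sqrt (t * total_var 1)"
proof -
  let ?m = "expectation (L t)" and ?e = "\<lambda>x. exp (\<i> * of_real (z \<bullet> x)) :: complex"
  have lip: "cmod (?e x - ?e ?m) \<le> norm z * norm (x - ?m)" for x
  proof -
    have "cmod (?e x - ?e ?m) \<le> \<bar>z \<bullet> x - z \<bullet> ?m\<bar>" by (rule norm_exp_ii_diff_le)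
    also have "\<dots> = \<bar>z \<bullet> (x - ?m)\<bar>" by (simp add: inner_diff_right)
    also have "\<dots> \<le> norm z * norm (x - ?m)" by (rule Cauchy_Schwarz_ineq2)
    finally show ?thesis .
  qed
  have D: "square_integrable P (\<lambda>\<omega>. L t \<omega> - ?m)" by (rule square_integrable_centered)
  have int_e: "integrable P (\<lambda>\<omega>. ?e (L t \<omega>))"
    by (rule integrable_const_bound[of _ 1]) simp_all
  have "exp (of_real t * levy_exponent \<gamma> S \<nu> z) - ?e ?m = expectation (\<lambda>\<omega>. ?e (L t \<omega>) - ?e ?m)"
    by (subst Bochner_Integration.integral_diff[OF int_e]) (simp_all add: char_fun_nonneg[OF assms] prob_space)
  also have "cmod \<dots> \<le> expectation (\<lambda>\<omega>. cmod (?e (L t \<omega>) - ?e ?m))"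
    by (rule integral_norm_bound)
  also have "\<dots> \<le> expectation (\<lambda>\<omega>. norm z * norm (L t \<omega> - ?m))"
    using int_e square_integrable_imp_integrable[OF D] lip by (intro integral_mono) auto
  also have "\<dots> = norm z * expectation (\<lambda>\<omega>. norm (L t \<omega> - ?m))" by simp
  also have "\<dots> \<le> norm z * sqrt (t * total_var 1)"
    using expectation_norm_square_le[OF D] total_var_eq[OF assms]
    by (intro mult_left_mono real_le_rsqrt) (auto simp: total_var_def)
  finally show ?thesis .
qed

text \<open>The mean is additive in time and vanishes at all rational times, but additivity alone does not make it
  linear. The phase \<open>exp (\<i> (z \<bullet> E L\<^sub>t))\<close> is close to the characteristic function for small \<open>t\<close>,
  hence continuous, which forces it to be constantly \<open>1\<close>.\<close>

lemma expectation_nonneg_time: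
  assumes "0 \<le> t"
  shows "expectation (L t) = 0"
proof -
  let ?m = "\<lambda>t. expectation (L t)"
  \<comment> \<open>The remainder of t modulo 1/(n + 1). The mean vanishes at multiples of 1/(n +
    1), so the mean at time \<open>r n\<close> equals the mean at time t, although
    \<open>r n\<close> tends to 0.\<close>
  define r where "r n = frac (real (Suc n) * t) / real (Suc n)" for n
  have r0: "0 \<le> r n" for n by (simp add: r_def)
  have mr: "?m (r n) = ?m t" for n
  proof -
    let ?k = "nat \<lfloor>real (Suc n) * t\<rfloor>"
    have "0 \<le> real (Suc n) * t" using assms by simp
    then have "real ?k = of_int \<lfloor>real (Suc n) * t\<rfloor>" by (simp del: of_nat_Suc)
    then have "t = real ?k * (1 / real (Suc n)) + r n"
      by (simp add: r_def frac_def field_simps del: of_nat_Suc)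
    then have "?m t = real ?k *\<^sub>R ?m (1 / real (Suc n)) + ?m (r n)"
      using expectation_add[of "real ?k * (1 / real (Suc n))" "r n"]
        expectation_of_nat_mult[of ?k "1 / real (Suc n)"] by simp
    moreover have "?m (1 / real (Suc n)) = 0"
      using expectation_of_nat_mult[of "Suc n" "1 / real (Suc n)"] centered by (simp del: of_nat_Suc)
    ultimately show ?thesis by simp
  qed
  have r_lim: "r \<longlonglongrightarrow> 0"
  proof (rule tendsto_sandwich[OF _ _ tendsto_const LIMSEQ_inverse_real_of_nat])
    have "r n \<le> 1 / real (Suc n)" for n
      unfolding r_def by (intro divide_right_mono) (simp_all add: frac_lt_1 less_imp_le del: of_nat_Suc)
    then show "\<forall>\<^sub>F n in sequentially. r n \<le> inverse (real (Suc n))" by (simp add: inverse_eq_divide)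
  qed (simp add: r0)
  have phase: "exp (\<i> * of_real (z \<bullet> ?m t)) = (1 :: complex)" for z
  proof -
    let ?\<psi> = "levy_exponent \<gamma> S \<nu> z"
    have "(\<lambda>n. exp (of_real (r n) * ?\<psi>)) \<longlonglongrightarrow> exp (of_real 0 * ?\<psi>)"
      by (intro tendsto_intros r_lim)
    moreover have "(\<lambda>n. exp (of_real (r n) * ?\<psi>) - exp (\<i> * of_real (z \<bullet> ?m t))) \<longlonglongrightarrow> 0"
    proof (rule Lim_null_comparison)
      show "\<forall>\<^sub>F n in sequentially. cmod (exp (of_real (r n) * ?\<psi>) - exp (\<i> * of_real (z \<bullet> ?m t)))
          \<le> norm z * sqrt (r n * total_var 1)"
        using char_fun_near_phase[OF r0, of _ z] by (simp add: mr)
      have "(\<lambda>n. norm z * sqrt (r n * total_var 1)) \<longlonglongrightarrow> norm z * sqrt (0 * total_var 1)"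
        by (intro tendsto_intros r_lim)
      then show "(\<lambda>n. norm z * sqrt (r n * total_var 1)) \<longlonglongrightarrow> 0" by simp
    qed
    ultimately have "(\<lambda>n::nat. exp (\<i> * of_real (z \<bullet> ?m t))) \<longlonglongrightarrow> (1 :: complex)"
      using tendsto_diff by fastforce
    then show ?thesis by (simp add: LIMSEQ_const_iff)
  qed
  show ?thesis
  proof (rule ccontr)
    \<comment> \<open>Scaling the mean to a vector whose inner product with it is pi turns the phase
      into -1.\<close>
    assume "?m t \<noteq> 0"
    then have "((pi / (norm (?m t))\<^sup>2) *\<^sub>R ?m t) \<bullet> ?m t = pi"
      by (simp add: power2_norm_eq_inner)
    from phase[of "(pi / (norm (?m t))\<^sup>2) *\<^sub>R ?m t", unfolded this] show False by simp
  qed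
qed

lemma expectation_L: "expectation (L t) = 0"
proof (cases "0 \<le> t")
  case False
  then show ?thesis
    using expectation_add[of t "- t"] expectation_nonneg_time[of "- t"] expectation_nonneg_time[of 0] by simp
qed (rule expectation_nonneg_time)

lemma variance_increment:
  "expectation (\<lambda>\<omega>. (norm (L t \<omega> - L s \<omega>))\<^sup>2) = total_var 1 * \<bar>t - s\<bar>"
proof -
  have le: "expectation (\<lambda>\<omega>. (norm (L t \<omega> - L s \<omega>))\<^sup>2) = total_var 1 * (t - s)" if "s \<le> t" for s t
    using expectation_increment_cong[of "\<lambda>x. (norm x)\<^sup>2" t s] total_var_eq[of "t - s"] that
    by (simp add: total_var_def expectation_L)
  show ?thesis
    using le[of s t] le[of t s] by (cases "s \<le> t") (auto simp: norm_minus_commute)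
qed

text \<open>Needed to move the real part inside the integral. The truncation leaves a second-order
  remainder near the origin and a bounded function away from it.\<close>

lemma integrable_levy_exponent:
  "integrable \<nu> (\<lambda>x. exp (\<i> * of_real (z \<bullet> x)) - 1 - \<i> * of_real (z \<bullet> x) * indicator {0..1} (norm x))"
  (is "integrable \<nu> ?g")
proof -
  have \<nu>: "levy_measure \<nu>"
    using levy by (simp add: two_sided_levy_process_def generating_triplet_def)
  then have sets [measurable_cong]: "sets \<nu> = sets borel" by (simp add: levy_measure_def)
  \<comment> \<open>The constant serves both regions: the summand \<open>(norm z)\<^sup>2\<close>
    covers the Taylor remainder on the unit ball, and 2 covers the difference of two unimodular
    numbers outside it.\<close>
  have "integrable \<nu> (\<lambda>x. (2 + (norm z)\<^sup>2) * min 1 ((norm x)\<^sup>2))"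
    using \<nu> by (intro integrable_mult_right integrableI_bounded) (auto simp: levy_measure_def)
  moreover have "cmod (?g x) \<le> (2 + (norm z)\<^sup>2) * min 1 ((norm x)\<^sup>2)" for x
  proof (cases "norm x \<le> 1")
    case True
    have "cmod (?g x) = cmod (exp (\<i> * of_real (z \<bullet> x)) - (\<Sum>k\<le>1. (\<i> * of_real (z \<bullet> x)) ^ k / fact k))"
      using True by (simp add: algebra_simps)
    also have "\<dots> \<le> \<bar>z \<bullet> x\<bar> ^ Suc 1 / fact (Suc 1)" by (rule iexp_approx1)
    also have "\<dots> \<le> \<bar>z \<bullet> x\<bar> ^ 2" by (simp add: power2_eq_square)
    also have "\<dots> \<le> (norm z * norm x) ^ 2" by (intro power_mono Cauchy_Schwarz_ineq2) simp
    also have "\<dots> \<le> (2 + (norm z)\<^sup>2) * (norm x)\<^sup>2" by (simp add: power_mult_distrib algebra_simps)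
    also have "(norm x)\<^sup>2 = min 1 ((norm x)\<^sup>2)" using True by (simp add: power_le_one)
    finally show ?thesis .
  next
    case False
    then have "cmod (?g x) \<le> cmod (exp (\<i> * of_real (z \<bullet> x))) + 1"
      using norm_triangle_ineq4[of "exp (\<i> * of_real (z \<bullet> x))" 1] by simp
    also have "\<dots> \<le> 2 + (norm z)\<^sup>2" by simp
    also have "\<dots> = (2 + (norm z)\<^sup>2) * min 1 ((norm x)\<^sup>2)" using False by (simp add: one_le_power)
    finally show ?thesis .
  qed
  ultimately show ?thesis
    by (elim Bochner_Integration.integrable_bound) (auto simp: abs_mult)
qed

text \<open>If L vanished almost surely at time 1, the exponent would have real part 0. That real
  part is a sum of a Gaussian and a jump term, neither of them positive, so the jump term is 0 and
  cos (z \<bullet> x) = 1 for \<nu>-almost every x, for each z. This puts all of \<nu> at the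
  origin, where a Levy measure has no mass.\<close>

lemma total_var_1_pos: "0 < total_var 1"
proof (rule ccontr)
  assume "\<not> 0 < total_var 1"
  moreover have "0 \<le> total_var 1" by (simp add: total_var_def)
  ultimately have "total_var 1 = 0" by simp
  then have "expectation (\<lambda>\<omega>. (norm (L 1 \<omega>))\<^sup>2) = 0" by (simp add: total_var_def expectation_L)
  then have L1: "AE \<omega> in P. L 1 \<omega> = 0"
    using second_moment by (subst (asm) integral_nonneg_eq_0_iff_AE) auto
  have \<nu>: "levy_measure \<nu>" and S: "\<And>z. 0 \<le> z \<bullet> (S *v z)"
    using levy by (auto simp: two_sided_levy_process_def generating_triplet_def)
  have sets [measurable_cong]: "sets \<nu> = sets borel" using \<nu> by (simp add: levy_measure_def)
  have cos: "AE x in \<nu>. cos (z \<bullet> x) = 1" for z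
  proof -
    let ?g = "\<lambda>x. exp (\<i> * of_real (z \<bullet> x)) - 1 - \<i> * of_real (z \<bullet> x) * indicator {0..1} (norm x)"
    have "expectation (\<lambda>\<omega>. exp (\<i> * of_real (z \<bullet> L 1 \<omega>))) = expectation (\<lambda>\<omega>. 1 :: complex)"
      using L1 by (intro integral_cong_AE) auto
    then have "exp (levy_exponent \<gamma> S \<nu> z) = 1"
      using char_fun_nonneg[of 1 z] by (simp add: prob_space)
    \<comment> \<open>Taking moduli avoids the ambiguity of the exponent by multiples of 2 pi
      \<i>.\<close>
    then have "exp (Re (levy_exponent \<gamma> S \<nu> z)) = 1" by (metis norm_exp_eq_Re norm_one)
    then have "Re (levy_exponent \<gamma> S \<nu> z) = 0" by simp
    moreover have "Re (levy_exponent \<gamma> S \<nu> z) = - (z \<bullet> (S *v z)) / 2 + Re (LINT x|\<nu>. ?g x)"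
      by (simp add: levy_exponent_def)
    moreover have "Re (LINT x|\<nu>. ?g x) = (LINT x|\<nu>. Re (?g x))"
      by (rule integral_Re[symmetric]) (rule integrable_levy_exponent)
    moreover have Re_g: "Re (?g x) = cos (z \<bullet> x) - 1" for x
      by (simp add: Re_exp indicator_def)
    ultimately have ge: "0 \<le> (LINT x|\<nu>. cos (z \<bullet> x) - 1)"
      using S[of z] unfolding Re_g by linarith
    have int: "integrable \<nu> (\<lambda>x. cos (z \<bullet> x) - 1)"
      using integrable_Re[OF integrable_levy_exponent[of z]] unfolding Re_g .
    have "(LINT x|\<nu>. 1 - cos (z \<bullet> x)) = - (LINT x|\<nu>. cos (z \<bullet> x) - 1)"
      by (subst integral_minus[symmetric]) simp
    moreover have "0 \<le> (LINT x|\<nu>. 1 - cos (z \<bullet> x))" by (rule Bochner_Integration.integral_nonneg) simp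
    ultimately have "(LINT x|\<nu>. 1 - cos (z \<bullet> x)) = 0" using ge by simp
    moreover have "integrable \<nu> (\<lambda>x. 1 - cos (z \<bullet> x))"
      using integrable_minus[OF int] by simp
    ultimately have "AE x in \<nu>. 1 - cos (z \<bullet> x) = 0"
      by (subst (asm) integral_nonneg_eq_0_iff_AE) auto
    then show ?thesis by eventually_elim simp
  qed
  \<comment> \<open>Countably many z keep the exceptional set null. For given x and large n the
    argument of the cosine has modulus below 1, so a cosine equal to 1 forces that coordinate of x
    to be 0.\<close>
  have "AE x in \<nu>. \<forall>n::nat. \<forall>b\<in>Basis. cos ((b /\<^sub>R real (Suc n)) \<bullet> x) = 1"
    unfolding AE_all_countable by (intro allI AE_finite_allI cos) simp
  then have "AE x in \<nu>. x = 0"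
  proof eventually_elim
    case (elim x)
    show ?case
    proof (rule euclidean_eqI)
      fix b :: "real ^ 'd" assume b: "b \<in> Basis"
      obtain n where "\<bar>x \<bullet> b\<bar> < real n" using reals_Archimedean2 by blast
      then have small: "\<bar>(b /\<^sub>R real (Suc n)) \<bullet> x\<bar> < 1"
        by (simp add: inner_commute abs_mult field_simps)
      have "cos ((b /\<^sub>R real (Suc n)) \<bullet> x) = 1" using elim b by blast
      then obtain k :: int where k: "(b /\<^sub>R real (Suc n)) \<bullet> x = of_int k * 2 * pi"
        unfolding cos_one_2pi_int by blast
      have "k = 0"
      proof (rule ccontr)
        assume "k \<noteq> 0"
        then have "1 \<le> \<bar>real_of_int k\<bar>" by linarith
        then have "1 * 1 \<le> \<bar>real_of_int k\<bar> * (2 * pi)"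
          using pi_gt3 by (intro mult_mono) auto
        with small show False unfolding k by (simp add: abs_mult)
      qed
      with k show "x \<bullet> b = 0 \<bullet> b" by (simp add: inner_commute del: of_nat_Suc)
    qed
  qed
  then have "emeasure \<nu> (space \<nu>) = emeasure \<nu> {0}"
    by (intro emeasure_eq_AE) auto
  moreover have "space \<nu> = UNIV" using sets_eq_imp_space_eq[OF sets] by simp
  ultimately show False using nontrivial \<nu> by (simp add: levy_measure_def)
qed

sublocale orthogonal_increments P L "total_var 1"
proof
  show "0 < total_var 1" by (rule total_var_1_pos)
  show "square_integrable P (\<lambda>\<omega>. L t \<omega> - L s \<omega>)" for s t
    by (intro square_integrable_diff square_integrable_L)
  show "expectation (\<lambda>\<omega>. L t \<omega> - L s \<omega>) = 0" for s t
    by (simp add: integrable_L expectation_L)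
  show "expectation (\<lambda>\<omega>. (norm (L t \<omega> - L s \<omega>))\<^sup>2) = total_var 1 * \<bar>t - s\<bar>" for s t
    by (rule variance_increment)
qed measurable

end

subsection \<open>Scattering of the Fourier transform\<close>

lemma interval_in_interval_ring: "a < b \<Longrightarrow> {a..<b} \<in> interval_ring"
  unfolding interval_ring_def by (rule hull_inc) blast

context orthogonal_increments
begin

text \<open>Makes the choice by \<open>SOME\<close> meaningful: the selected version really is an
  integral of the transform.\<close>

lemma has_L2_integral_fourier_indicator:
  assumes "a < b"
  shows "has_L2_integral P L (fourier_indicator {a..<b}) (L2_integral P L (fourier_indicator {a..<b}))"
proof -
  obtain K where K: "\<And>\<mu> \<mu>'. cmod (fourier_indicator {a..<b} \<mu> - fourier_indicator {a..<b} \<mu>') \<le> K * \<bar>\<mu> - \<mu>'\<bar>"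
    using lipschitz_fourier_indicator_Ico[OF assms] by blast
  have "\<exists>X. has_L2_integral P L (fourier_indicator {a..<b}) X"
    using assms square_integrable_fourier_indicator_Ico
    by (intro has_L2_integral_exists[OF _ _ grid_steps_approx[OF _ K]] step_repr_grid_steps) auto
  then show ?thesis unfolding L2_integral_def by (rule someI_ex)
qed

lemma vec_cnj_L2_integral_fourier_indicator:
  assumes "a < b"
  shows "AE \<omega> in P. vec_cnj (L2_integral P L (fourier_indicator {a..<b}) \<omega>)
    = L2_integral P L (fourier_indicator {- b..<- a}) \<omega>"
proof -
  have "AE \<mu> in lborel. \<mu> \<noteq> (0 :: real)" by (rule AE_lborel_singleton)
  then have "AE \<mu> in lborel. cnj (fourier_indicator {a..<b} \<mu>) = fourier_indicator {- b..<- a} \<mu>"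
    by eventually_elim (rule cnj_fourier_indicator_Ico[OF assms])
  moreover have "- b < - a" using assms by simp
  ultimately show ?thesis
    using has_L2_integral_AE_eq_iff[OF has_L2_integral_cnj[OF has_L2_integral_fourier_indicator[OF assms]]
        has_L2_integral_fourier_indicator] by blast
qed

text \<open>A real integral would have an integrand that is real almost everywhere, hence everywhere
  by continuity, in contradiction to its value at frequency pi.\<close>

lemma L2_integral_fourier_indicator_not_real:
  "\<not> (AE \<omega> in P. vec_cnj (L2_integral P L (fourier_indicator {0..<1}) \<omega>)
    = L2_integral P L (fourier_indicator {0..<1}) \<omega>)"
proof
  let ?f = "fourier_indicator {0..<1}"
  have f: "has_L2_integral P L ?f (L2_integral P L ?f)"
    by (rule has_L2_integral_fourier_indicator) simp
  assume "AE \<omega> in P. vec_cnj (L2_integral P L ?f \<omega>) = L2_integral P L ?f \<omega>"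
  then have "AE \<mu> in lborel. cnj (?f \<mu>) = ?f \<mu>"
    using has_L2_integral_AE_eq_iff[OF has_L2_integral_cnj[OF f] f] by blast
  then have "cnj (?f pi) = ?f pi"
    by (intro AE_eq_imp_eq_continuous[of "\<lambda>\<mu>. cnj (?f \<mu>)"])
      (auto intro!: continuous_intros continuous_fourier_indicator_Ico)
  then show False using fourier_indicator_Ico_pi by (simp add: complex_eq_iff)
qed

end

text \<open>The integral is fixed only up to null sets, so \<open>M\<close> stands for any
  measurable version of it on the ring.\<close>

theorem mainTheorem4:
  fixes P :: "'a measure"
    and L :: "real \<Rightarrow> 'a \<Rightarrow> real ^ 'd"
    and \<gamma> :: "real ^ 'd" and S :: "real ^ 'd ^ 'd" and \<nu> :: "(real ^ 'd) measure"
    and M :: "real set \<Rightarrow> 'a \<Rightarrow> complex ^ 'd"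
  assumes "two_sided_levy_process P L \<gamma> S \<nu>"
    and "prob_space.expectation P (L 1) = 0"
    and "integrable P (\<lambda>\<omega>. (norm (L 1 \<omega>))\<^sup>2)"
    and "emeasure \<nu> UNIV \<noteq> 0"
    and "\<And>A. A \<in> interval_ring \<Longrightarrow> M A \<in> borel_measurable P"
    and "\<And>A. A \<in> interval_ring \<Longrightarrow>
           AE \<omega> in P. M A \<omega> = (1 / sqrt (2 * pi)) *\<^sub>R L2_integral P L (fourier_indicator A) \<omega>"
  shows "\<not> independently_scattered P M \<and> \<not> stationarily_scattered P M"
proof -
  interpret centered_levy P L \<gamma> S \<nu>
    using assms(1-4)
    by (intro centered_levy.intro centered_levy_axioms.intro) (simp_all add: two_sided_levy_process_def)
  let ?c = "1 / sqrt (2 * pi)" and ?I = "\<lambda>a b. L2_integral P L (fourier_indicator {a..<b})"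
  have M_meas [measurable]: "M {a..<b} \<in> borel_measurable P" if "a < b" for a b
    using assms(5) interval_in_interval_ring[OF that] .
  have M_eq: "AE \<omega> in P. M {a..<b} \<omega> = ?c *\<^sub>R ?I a b \<omega>" if "a < b" for a b
    using assms(6) interval_in_interval_ring[OF that] .
  have M_cnj: "AE \<omega> in P. vec_cnj (M {a..<b} \<omega>) = M {- b..<- a} \<omega>" if "a < b" for a b
  proof -
    have "- b < - a" using that by simp
    from M_eq[OF that] M_eq[OF this] vec_cnj_L2_integral_fourier_indicator[OF that] show ?thesis
      by eventually_elim (simp add: linear_scale[OF linear_vec_cnj])
  qed
  have not_real: "\<not> (AE \<omega> in P. vec_cnj (M {0..<1} \<omega>) = M {0..<1} \<omega>)"
  proof
    assume "AE \<omega> in P. vec_cnj (M {0..<1} \<omega>) = M {0..<1} \<omega>"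
    with M_eq[OF zero_less_one] have "AE \<omega> in P. vec_cnj (?I 0 1 \<omega>) = ?I 0 1 \<omega>"
      by eventually_elim (simp add: linear_scale[OF linear_vec_cnj])
    with L2_integral_fourier_indicator_not_real show False by contradiction
  qed
  have "\<not> independently_scattered P M"
  proof
    assume scattered: "independently_scattered P M"
    define A :: "nat \<Rightarrow> real set" where "A i = (if i = 0 then {0..<1} else {- 1..<0})" for i
    have "(\<forall>i<2. A i \<in> interval_ring) \<and> disjoint_family_on A {..<2}"
      by (auto simp: A_def interval_in_interval_ring disjoint_family_on_def)
    with scattered have "indep_vars (\<lambda>_. borel) (\<lambda>i. M (A i)) {..<2}"
      unfolding independently_scattered_def by blast
    from indep_vars_imp_indep_var[OF this, of 0 1]
    have "indep_var borel (M {0..<1}) borel (M {- 1..<0})" by (simp add: A_def)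
    \<comment> \<open>Conjugating the second variable makes it almost surely equal to the first.
      Their real inner product is then the squared norm, and its expectation factors into a product
      with a vanishing mean.\<close>
    from indep_var_compose[OF this, of "\<lambda>x. x" borel vec_cnj borel]
    have indep: "indep_var borel (M {0..<1}) borel (\<lambda>\<omega>. vec_cnj (M {- 1..<0} \<omega>))"
      by (simp add: comp_def)
    have sq: "square_integrable P (M {a..<b})" if "a < b" for a b
    proof (rule square_integrable_bound)
      show "square_integrable P (?I a b)"
        using has_L2_integral_fourier_indicator[OF that] by (simp add: has_L2_integral_iff)
      \<comment> \<open>The normalizing factor is at most 1, so the integral itself dominates
        \<open>M\<close> in norm.\<close>
      have "1 \<le> sqrt (2 * pi)" using pi_gt3 by (simp add: real_le_rsqrt)
      then have small: "norm (?c *\<^sub>R x) \<le> norm x" for x :: "complex ^ 'd"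
        using mult_left_mono[of 1 "sqrt (2 * pi)" "norm x"] by (simp add: divide_le_eq)
      show "AE \<omega> in P. norm (M {a..<b} \<omega>) \<le> norm (?I a b \<omega>)"
        using M_eq[OF that] by eventually_elim (simp only: small)
    qed (use that in simp)
    have sq_cnj: "square_integrable P (\<lambda>\<omega>. vec_cnj (M {- 1..<0} \<omega>))"
      by (rule square_integrable_bound[OF sq[of "- 1" 0]]) simp_all
    have "expectation (M {0..<1}) = expectation (\<lambda>\<omega>. ?c *\<^sub>R ?I 0 1 \<omega>)"
      using has_L2_integral_fourier_indicator[of 0 1]
      by (intro integral_cong_AE M_eq) (auto simp: has_L2_integral_def)
    also have "\<dots> = 0"
      using expectation_has_L2_integral[OF has_L2_integral_fourier_indicator[of 0 1]] by simp
    finally have "expectation (\<lambda>\<omega>. M {0..<1} \<omega> \<bullet> vec_cnj (M {- 1..<0} \<omega>)) = 0"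
      using indep_var_expectation_inner[OF indep sq sq_cnj] by simp
    moreover have "AE \<omega> in P. M {0..<1} \<omega> \<bullet> vec_cnj (M {- 1..<0} \<omega>) = (norm (M {0..<1} \<omega>))\<^sup>2"
    proof -
      have "AE \<omega> in P. vec_cnj (M {- 1..<0} \<omega>) = M {0..<1} \<omega>"
        using M_cnj[of "- 1" 0] by simp
      then show ?thesis by eventually_elim (simp add: power2_norm_eq_inner)
    qed
    then have "expectation (\<lambda>\<omega>. M {0..<1} \<omega> \<bullet> vec_cnj (M {- 1..<0} \<omega>))
        = expectation (\<lambda>\<omega>. (norm (M {0..<1} \<omega>))\<^sup>2)"
      by (intro integral_cong_AE) auto
    ultimately have "expectation (\<lambda>\<omega>. (norm (M {0..<1} \<omega>))\<^sup>2) = 0" by simp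
    then have "AE \<omega> in P. M {0..<1} \<omega> = 0"
      using sq[of 0 1] by (subst (asm) integral_nonneg_eq_0_iff_AE) (auto simp: square_integrable_def)
    then have "AE \<omega> in P. vec_cnj (M {0..<1} \<omega>) = M {0..<1} \<omega>"
      by eventually_elim (simp add: linear_0[OF linear_vec_cnj])
    with not_real show False by contradiction
  qed
  moreover have "\<not> stationarily_scattered P M"
  proof
    assume scattered: "stationarily_scattered P M"
    have shift: "(\<lambda>x. x + 1 / 2) ` {- (1 / 2)..<1 / 2} = {0..<1 :: real}"
      using image_add_atLeastLessThan[of "1 / 2 :: real" "- (1 / 2)" "1 / 2"] by (simp add: add.commute)
    \<comment> \<open>Distributions indexed by a single set suffice; evaluation at index 0 turns the
      one-factor product law into the law of the variable.\<close>
    let ?\<Pi> = "\<Pi>\<^sub>M i\<in>{..<1::nat}. borel :: (complex ^ 'd) measure"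
    let ?T = "\<lambda>X \<omega>. \<lambda>i\<in>{..<1::nat}. X \<omega>"
    have T: "?T X \<in> measurable P ?\<Pi>" if "X \<in> borel_measurable P" for X :: "'a \<Rightarrow> complex ^ 'd"
      using that by (intro measurable_restrict)
    have marginal: "distr (distr P ?\<Pi> (?T X)) borel (\<lambda>f. f 0) = distr P borel X"
      if "X \<in> borel_measurable P" for X :: "'a \<Rightarrow> complex ^ 'd"
      by (subst distr_distr[OF measurable_component_singleton T[OF that]]) (auto simp: comp_def)
    have "distr P ?\<Pi> (?T (M {- (1 / 2)..<1 / 2})) = distr P ?\<Pi> (?T (M {0..<1}))"
      using scattered[unfolded stationarily_scattered_def, rule_format,
          of 1 "\<lambda>_. {- (1 / 2)..<1 / 2}" "1 / 2"] interval_in_interval_ring[of "- (1 / 2)" "1 / 2"]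
      by (simp only: shift)
    then have distr: "distr P borel (M {- (1 / 2)..<1 / 2}) = distr P borel (M {0..<1})"
      using marginal[OF M_meas[of "- (1 / 2)" "1 / 2"]] marginal[OF M_meas[of 0 1]] by simp
    have "AE \<omega> in P. vec_cnj (M {- (1 / 2)..<1 / 2} \<omega>) = M {- (1 / 2)..<1 / 2} \<omega>"
      using M_cnj[of "- (1 / 2)" "1 / 2"] by simp
    \<comment> \<open>Being almost surely real is a property of the law alone, so equality of laws
      transfers it.\<close>
    then have "AE x in distr P borel (M {- (1 / 2)..<1 / 2}). vec_cnj x = x"
      by (subst AE_distr_iff) simp_all
    then have "AE x in distr P borel (M {0..<1}). vec_cnj x = x" unfolding distr .
    then have "AE \<omega> in P. vec_cnj (M {0..<1} \<omega>) = M {0..<1} \<omega>"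
      by (subst (asm) AE_distr_iff) simp_all
    with not_real show False by contradiction
  qed
  ultimately show ?thesis by simp
qed

end
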